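(* Let $\sigma\in(0,1)$, let $\mathcal{C}\subseteq\mathbb{R}^2$ be a curve (of finite length, not necessarily connected), let $z\in\mathbb{R}^2$, and let $\mathbf{u}$ be a unit vector, where, if $z\in\mathcal{C}$, $\mathbf{u}$ is one of the unit normals to $\mathcal{C}$ at $z$. For every $n\in\mathbb{N}$ (natural numbers starting at $1$), define the set $$\mathcal{C}_n:=\big\{p\in\mathcal{C} \ \big|\ \big|\{\lambda p+(1-\lambda)z \mid \lambda\in(0,1]\}\cap\mathcal{C}\big|=n\big\},$$ where $|\cdot|$ of a set denotes its number of elements. It follows that $$\kappa_\sigma(z,\mathcal{C},\mathbf{u})=\sum_{n\in\mathbb{N}}(-1)^{n+1}\kappa_\sigma(z,\mathcal{C}_n,\mathbf{u})$$ and $$\kappa_\sigma(z,\mathcal{C},\mathbf{u})=\lim_{N\to\infty}\kappa_\sigma\Big(z,\bigcup_{n=1}^N\mathcal{C}_n,\mathbf{u}\Big).$$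
   Context: Curves. A curve $\mathcal{C}$ is a one-dimensional $C^1$ manifold with boundary in $\mathbb{R}^2$ (a simple, $C^1$ planar curve, not necessarily connected) of finite length. Some or all endpoints may be removed, and the definitions below also make sense when $\mathcal{C}$ is only piecewise $C^1$ (if $z\in\mathcal{C}$, then $z$ must be a point where $\mathcal{C}$ is $C^1$). For $x,y\in\mathbb{R}^2$, $[x,y]$ denotes the closed line segment with endpoints $x$ and $y$. Transversality. An open line segment $\mathcal{L}$ and $\mathcal{C}$ are transversal if at every $p\in\mathcal{L}\cap\mathcal{C}$ the tangent to $\mathcal{C}$ at $p$ is not parallel to $\mathcal{L}$. $\mathcal{X}(\mathcal{C})$ is the set of all pairs $(x,y)\in\mathbb{R}^2\times\mathbb{R}^2$ such that the open line segment $\mathcal{L}$ connecting $x$ and $y$ is transversal to $\mathcal{C}$ and $\mathcal{C}\cap\mathcal{L}$ has an odd number of elements; $\mathcal{X}(\mathcal{C})^c$ is its complement. Nonlocal curvature. For $z\in\mathcal{C}$ and a unit normal $\mathbf{u}$ to $\mathcal{C}$ at $z$, set $$\mathcal{A}_e(z)=\{y \mid ((z,y)\in\mathcal{X}(\mathcal{C})\text{ and }(z-y)\cdot\mathbf{u}>0)\text{ or }((z,y)\in\mathcal{X}(\mathcal{C})^c\text{ and }(z-y)\cdot\mathbf{u}<0)\},$$ $$\mathcal{A}_i(z)=\{y \mid ((z,y)\in\mathcal{X}(\mathcal{C})^c\text{ and }(z-y)\cdot\mathbf{u}>0)\text{ or }((z,y)\in\mathcal{X}(\mathcal{C})\text{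 and }(z-y)\cdot\mathbf{u}<0)\},$$ let $\widehat\chi_{\mathcal{C}}(z,y)$ equal $1$ if $y\in\mathcal{A}_i(z)$, $-1$ if $y\in\mathcal{A}_e(z)$, and $0$ otherwise, and define (principal value) $$\kappa_\sigma(z,\mathcal{C},\mathbf{u})=\lim_{\varepsilon\to0}\frac12\int_{\mathbb{R}^2\setminus B_\varepsilon(z)}\frac{\widehat\chi_{\mathcal{C}}(z,y)}{|z-y|^{2+\sigma}}\,dy,$$ where $B_\varepsilon(z)$ is the ball of radius $\varepsilon$ centered at $z$. For $z\notin\mathcal{C}$ and an arbitrary unit vector $\mathbf{u}$, define $$\kappa_\sigma(z,\mathcal{C},\mathbf{u})=\lim_{\delta\downarrow0}\kappa_\sigma(z,\mathcal{C}\cup[z-\delta\mathbf{u}^\perp,z+\delta\mathbf{u}^\perp],\mathbf{u}),$$ where $\mathbf{u}^\perp$ is $\mathbf{u}$ rotated clockwise by $90^\circ$. In particular $\kappa_\sigma(z,\emptyset,\mathbf{u})=0$.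
   Formalization: For z in the closure of C two assumptions are added: all curvatures of the layers C_n exist, and for some m the kernel |z-y|^(-2-σ) is integrable over {y : (z,y) ∈ X(C_m)}. Without them the curvatures may be undefined or the series may diverge. *)

theory Defs
  imports "HOL-Analysis.Analysis"
begin

section \<open>Curves\<close>

text \<open>
  One-dimensional Hausdorff measure, i.e. the length of a planar curve that need not be
  connected or compact.
\<close>

definition curve_length :: "(real^2) set \<Rightarrow> ennreal" where
  "curve_length A =
     (SUP \<delta>\<in>{0<..}.
       INF E\<in>{E :: nat \<Rightarrow> (real^2) set.
                A \<subseteq> (\<Union>i. E i) \<and> (\<forall>i. bounded (E i) \<and> diameter (E i) \<le> \<delta>)}.
         \<Sum>i. ennreal (diameter (E i)))"

text \<open>
  Embedded one-dimensional \<open>C\<^sup>1\<close> submanifold with boundary: near each of its points the set is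
  the homeomorphic image of a nondegenerate interval under a regular \<open>C\<^sup>1\<close> map.  A point
  parametrized by an end of the interval \<open>I\<close> is a boundary point.  The set is not required to be
  closed, so removing endpoints from a curve gives a curve.
\<close>

definition C1_manifold_1d :: "(real^2) set \<Rightarrow> bool" where
  "C1_manifold_1d C \<longleftrightarrow>
     (\<forall>p\<in>C. \<exists>U (I :: real set) \<gamma> \<gamma>' \<tau>.
        open U \<and> p \<in> U \<and> is_interval I \<and> interior I \<noteq> {} \<and>
        homeomorphism I (C \<inter> U) \<gamma> \<tau> \<and>
        (\<forall>t\<in>I. (\<gamma> has_vector_derivative \<gamma>' t) (at t within I) \<and> \<gamma>' t \<noteq> 0) \<and>
        continuous_on I \<gamma>')"

definition planar_curve :: "(real^2) set \<Rightarrow> bool" where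
  "planar_curve C \<longleftrightarrow> C1_manifold_1d C \<and> curve_length C < \<infinity>"

text \<open>
  Tangent vectors are taken in the sense of the (Bouligand) tangent cone, because transversality
  is also applied to subsets of curves and to unions with a segment, which need not be manifolds.
  At a point of a \<open>C\<^sup>1\<close> manifold the cone is the usual tangent line (a half-line of it at a
  boundary point).
\<close>

definition tangent_cone :: "(real^2) set \<Rightarrow> real^2 \<Rightarrow> (real^2) set" where
  "tangent_cone S p =
     {v. \<exists>q c. (\<forall>k :: nat. q k \<in> S \<and> 0 < c k) \<and> q \<longlonglongrightarrow> p \<and> (\<lambda>k. c k *\<^sub>R (q k - p)) \<longlonglongrightarrow> v}"

lemma tangent_cone_C1_subset:
  assumes hom: "homeomorphism I (C \<inter> U) \<gamma> \<tau>" and "open U" "t \<in> I"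
    and der: "(\<gamma> has_vector_derivative d) (at t within I)" and "d \<noteq> 0"
  shows "tangent_cone C (\<gamma> t) \<subseteq> span {d}"
proof
  fix v assume "v \<in> tangent_cone C (\<gamma> t)"
  then obtain q c where q: "\<And>k. q k \<in> C" "\<And>k. 0 < c k" "q \<longlonglongrightarrow> \<gamma> t"
    and lim: "(\<lambda>k. c k *\<^sub>R (q k - \<gamma> t)) \<longlonglongrightarrow> v"
    by (auto simp: tangent_cone_def)
  have p: "\<gamma> t \<in> C \<inter> U" using hom \<open>t \<in> I\<close> by (auto simp: homeomorphism_def)
  have evU: "\<forall>\<^sub>F k in sequentially. q k \<in> C \<inter> U"
    using topological_tendstoD[OF q(3) \<open>open U\<close>] p q(1) by (auto elim: eventually_mono)
  define s where "s = (\<lambda>k. \<tau> (q k))"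
  have "continuous (at (\<gamma> t) within C \<inter> U) \<tau>"
    using hom p by (simp add: homeomorphism_def continuous_on_eq_continuous_within)
  then have "s \<longlonglongrightarrow> \<tau> (\<gamma> t)"
    unfolding s_def using q(3) evU p
    by (intro continuous_within_tendsto_compose[where f = \<tau> and S = "C \<inter> U"]) auto
  then have s: "s \<longlonglongrightarrow> t"
    using hom \<open>t \<in> I\<close> by (simp add: homeomorphism_def)
  have evs: "\<forall>\<^sub>F k in sequentially. s k \<in> I \<and> \<gamma> (s k) = q k"
    using evU by eventually_elim (use hom in \<open>auto simp: s_def homeomorphism_def\<close>)
  have "(\<lambda>k. c k *\<^sub>R (q k - \<gamma> t) - (c k * (s k - t)) *\<^sub>R d) \<longlonglongrightarrow> 0"
  proof (rule tendstoI)
    fix e :: real assume "e > 0"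
    define M where "M = norm v + 1"
    define e' where "e' = min (norm d / 2) (e * norm d / (4 * M))"
    have "M > 0" by (simp add: M_def add_nonneg_pos)
    then have "e' > 0" using \<open>e > 0\<close> \<open>d \<noteq> 0\<close> by (simp add: e'_def)
    then obtain r where r: "r > 0"
      "\<And>y. y \<in> I \<Longrightarrow> norm (y - t) < r \<Longrightarrow> norm (\<gamma> y - \<gamma> t - (y - t) *\<^sub>R d) \<le> e' * norm (y - t)"
      using der unfolding has_vector_derivative_def has_derivative_within_alt by metis
    have "\<forall>\<^sub>F k in sequentially. norm (c k *\<^sub>R (q k - \<gamma> t)) < M"
      using tendsto_norm[OF lim] by (rule order_tendstoD) (simp add: M_def)
    moreover have "\<forall>\<^sub>F k in sequentially. dist (s k) t < r"
      using s \<open>r > 0\<close> by (rule tendstoD)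
    ultimately show "\<forall>\<^sub>F k in sequentially.
        dist (c k *\<^sub>R (q k - \<gamma> t) - (c k * (s k - t)) *\<^sub>R d) 0 < e"
      using evs
    proof eventually_elim
      case (elim k)
      let ?a = "c k * \<bar>s k - t\<bar>" and ?w = "c k *\<^sub>R (q k - \<gamma> t)"
      have "?a \<ge> 0" using q(2)[of k] by simp
      have "norm (q k - \<gamma> t - (s k - t) *\<^sub>R d) \<le> e' * \<bar>s k - t\<bar>"
        using r(2)[of "s k"] elim by (simp add: dist_norm)
      then have "c k * norm (q k - \<gamma> t - (s k - t) *\<^sub>R d) \<le> c k * (e' * \<bar>s k - t\<bar>)"
        using q(2)[of k] by (intro mult_left_mono) auto
      moreover have "norm (?w - (c k * (s k - t)) *\<^sub>R d)
          = c k * norm (q k - \<gamma> t - (s k - t) *\<^sub>R d)"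
      proof -
        have "?w - (c k * (s k - t)) *\<^sub>R d = c k *\<^sub>R (q k - \<gamma> t - (s k - t) *\<^sub>R d)"
          by (simp add: scaleR_diff_right)
        then show ?thesis using q(2)[of k] by simp
      qed
      ultimately have 1: "norm (?w - (c k * (s k - t)) *\<^sub>R d) \<le> e' * ?a"
        by (simp add: mult_ac)
      have "norm ((c k * (s k - t)) *\<^sub>R d) = ?a * norm d"
        using q(2)[of k] by (simp add: abs_mult)
      moreover have "norm ((c k * (s k - t)) *\<^sub>R d)
          \<le> norm ?w + norm (?w - (c k * (s k - t)) *\<^sub>R d)"
        by (metis norm_minus_commute norm_triangle_sub)
      moreover have "e' * ?a \<le> norm d / 2 * ?a"
        using \<open>?a \<ge> 0\<close> by (intro mult_right_mono) (auto simp: e'_def)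
      ultimately have "?a * norm d \<le> M + norm d / 2 * ?a"
        using 1 elim by linarith
      then have "?a * norm d \<le> 2 * M" by (simp add: mult_ac)
      then have a: "?a \<le> 2 * M / norm d" using \<open>d \<noteq> 0\<close> by (simp add: field_simps)
      have "e' * ?a \<le> e * norm d / (4 * M) * (2 * M / norm d)"
        using a \<open>?a \<ge> 0\<close> \<open>e' > 0\<close> \<open>e > 0\<close> \<open>M > 0\<close>
        by (intro mult_mono) (auto simp: e'_def)
      also have "\<dots> = e / 2" using \<open>d \<noteq> 0\<close> \<open>M > 0\<close> by simp
      finally show ?case using 1 \<open>e > 0\<close> by simp
    qed
  qed
  from tendsto_diff[OF lim this] have "(\<lambda>k. (c k * (s k - t)) *\<^sub>R d) \<longlonglongrightarrow> v" by simp
  then show "v \<in> span {d}"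
    by (rule closed_sequentially[OF closed_span, rotated]) (simp add: span_base span_scale)
qed

lemma tangent_cone_C1_nontrivial:
  assumes hom: "homeomorphism I (C \<inter> U) \<gamma> \<tau>" and "t \<in> I" and I: "is_interval I" "interior I \<noteq> {}"
    and der: "(\<gamma> has_vector_derivative d) (at t within I)"
  shows "d \<in> tangent_cone C (\<gamma> t) \<or> - d \<in> tangent_cone C (\<gamma> t)"
proof -
  have "\<not> I \<subseteq> {t}"
    using I(2) interior_mono[of I "{t}"] by auto
  then obtain s where "s \<in> I" "s \<noteq> t" by auto
  define x where "x = (\<lambda>k. t + (s - t) / real (Suc k))"
  have xI: "x k \<in> I" for k
  proof -
    have "x k = (1 - 1 / real (Suc k)) *\<^sub>R t + (1 / real (Suc k)) *\<^sub>R s"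
      unfolding x_def real_scaleR_def by (simp only: left_diff_distrib diff_divide_distrib) simp
    also have "\<dots> \<in> I"
      using is_interval_convex[OF I(1)] \<open>s \<in> I\<close> \<open>t \<in> I\<close> by (intro convexD_alt) auto
    finally show ?thesis .
  qed
  have xt: "x k \<noteq> t" for k using \<open>s \<noteq> t\<close> by (simp add: x_def)
  have "(\<lambda>k. t + (s - t) * (1 / real (Suc k))) \<longlonglongrightarrow> t + (s - t) * 0"
    using LIMSEQ_inverse_real_of_nat by (intro tendsto_intros) (simp add: inverse_eq_divide)
  then have "x \<longlonglongrightarrow> t" by (simp add: x_def)
  then have fx: "filterlim x (at t within I) sequentially"
    using xI xt by (simp add: filterlim_at)
  have q: "(\<lambda>k. \<gamma> (x k)) \<longlonglongrightarrow> \<gamma> t"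
    using has_vector_derivative_continuous[OF der] fx
    by (auto simp: continuous_within intro: filterlim_compose)
  have "((\<lambda>y. (1 / norm (y - t)) *\<^sub>R (\<gamma> y - (\<gamma> t + (y - t) *\<^sub>R d))) \<longlongrightarrow> 0) (at t within I)"
    using der unfolding has_vector_derivative_def has_derivative_within by simp
  then have l: "(\<lambda>k. (1 / norm (x k - t)) *\<^sub>R (\<gamma> (x k) - (\<gamma> t + (x k - t) *\<^sub>R d))) \<longlonglongrightarrow> 0"
    using fx by (rule filterlim_compose)
  have mem: "\<gamma> (x k) \<in> C" for k using hom xI by (auto simp: homeomorphism_def)
  let ?c = "\<lambda>k. inverse \<bar>x k - t\<bar>"
  have c: "0 < ?c k" for k using xt by simp
  have w: "(1 / norm (x k - t)) *\<^sub>R (\<gamma> (x k) - (\<gamma> t + (x k - t) *\<^sub>R d))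
      = ?c k *\<^sub>R (\<gamma> (x k) - \<gamma> t) - sgn (s - t) *\<^sub>R d" for k
  proof -
    have "(1 / \<bar>x k - t\<bar>) * (x k - t) = sgn (s - t)"
      by (simp add: x_def real_sgn_eq del: of_nat_Suc)
    then show ?thesis
      by (simp only: real_norm_def scaleR_diff_right scaleR_add_right scaleR_scaleR)
         (simp add: inverse_eq_divide)
  qed
  have "(\<lambda>k. ?c k *\<^sub>R (\<gamma> (x k) - \<gamma> t)) \<longlonglongrightarrow> sgn (s - t) *\<^sub>R d"
    using l unfolding w by (rule LIM_zero_cancel)
  then have "sgn (s - t) *\<^sub>R d \<in> tangent_cone C (\<gamma> t)"
    unfolding tangent_cone_def mem_Collect_eq
    by (intro exI[of _ "\<lambda>k. \<gamma> (x k)"] exI[of _ ?c]) (use mem c q in auto)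
  then show ?thesis using \<open>s \<noteq> t\<close> by (auto simp: sgn_if split: if_splits)
qed

definition unit_normal :: "(real^2) set \<Rightarrow> real^2 \<Rightarrow> real^2 \<Rightarrow> bool" where
  "unit_normal C z u \<longleftrightarrow> norm u = 1 \<and> (\<forall>v\<in>tangent_cone C z. v \<bullet> u = 0)"

section \<open>Crossings\<close>

definition transversal :: "real^2 \<Rightarrow> real^2 \<Rightarrow> (real^2) set \<Rightarrow> bool" where
  "transversal x y C \<longleftrightarrow>
     (\<forall>p\<in>open_segment x y \<inter> C. \<forall>v\<in>tangent_cone C p. v \<noteq> 0 \<longrightarrow> v \<notin> span {y - x})"

text \<open>An infinite intersection has cardinality \<open>0\<close>, so it does not count as odd.\<close>

definition crossing_pairs :: "(real^2) set \<Rightarrow> ((real^2) \<times> (real^2)) set" where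
  "crossing_pairs C = {(x, y). transversal x y C \<and> odd (card (C \<inter> open_segment x y))}"

section \<open>Nonlocal curvature\<close>

definition ext_region :: "(real^2) set \<Rightarrow> real^2 \<Rightarrow> real^2 \<Rightarrow> (real^2) set" where
  "ext_region C u z =
     {y. (z, y) \<in> crossing_pairs C \<and> (z - y) \<bullet> u > 0 \<or>
         (z, y) \<in> - crossing_pairs C \<and> (z - y) \<bullet> u < 0}"

definition int_region :: "(real^2) set \<Rightarrow> real^2 \<Rightarrow> real^2 \<Rightarrow> (real^2) set" where
  "int_region C u z =
     {y. (z, y) \<in> - crossing_pairs C \<and> (z - y) \<bullet> u > 0 \<or>
         (z, y) \<in> crossing_pairs C \<and> (z - y) \<bullet> u < 0}"

definition chi_hat :: "(real^2) set \<Rightarrow> real^2 \<Rightarrow> real^2 \<Rightarrow> real^2 \<Rightarrow> real" where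
  "chi_hat C u z y =
     (if y \<in> int_region C u z then 1 else if y \<in> ext_region C u z then - 1 else 0)"

text \<open>
  The principal value, for \<open>z\<close> on the curve.  Integrability is part of the predicate so that the
  default value of a nonexistent integral plays no role.
\<close>

definition has_pv_curvature ::
    "real \<Rightarrow> real^2 \<Rightarrow> (real^2) set \<Rightarrow> real^2 \<Rightarrow> real \<Rightarrow> bool" where
  "has_pv_curvature \<sigma> z C u k \<longleftrightarrow>
     (\<forall>\<epsilon>>0. set_integrable lebesgue (- ball z \<epsilon>)
              (\<lambda>y. chi_hat C u z y / norm (z - y) powr (2 + \<sigma>))) \<and>
     ((\<lambda>\<epsilon>. 1 / 2 * set_lebesgue_integral lebesgue (- ball z \<epsilon>)
              (\<lambda>y. chi_hat C u z y / norm (z - y) powr (2 + \<sigma>)))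
        \<longlongrightarrow> k) (at_right 0)"

text \<open>Clockwise rotation by 90 degrees.\<close>

definition rot_cw :: "real^2 \<Rightarrow> real^2" where
  "rot_cw u = vector [u $ 2, - u $ 1]"

definition has_nonlocal_curvature ::
    "real \<Rightarrow> real^2 \<Rightarrow> (real^2) set \<Rightarrow> real^2 \<Rightarrow> real \<Rightarrow> bool" where
  "has_nonlocal_curvature \<sigma> z C u k \<longleftrightarrow>
     (if z \<in> C then has_pv_curvature \<sigma> z C u k
      else \<exists>K. (\<forall>\<^sub>F \<delta> in at_right 0.
                  has_pv_curvature \<sigma> z
                    (C \<union> closed_segment (z - \<delta> *\<^sub>R rot_cw u) (z + \<delta> *\<^sub>R rot_cw u)) u (K \<delta>)) \<and>
               (K \<longlongrightarrow> k) (at_right 0))"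

definition nonlocal_curvature_exists ::
    "real \<Rightarrow> real^2 \<Rightarrow> (real^2) set \<Rightarrow> real^2 \<Rightarrow> bool" where
  "nonlocal_curvature_exists \<sigma> z C u \<longleftrightarrow> (\<exists>k. has_nonlocal_curvature \<sigma> z C u k)"

definition nonlocal_curvature :: "real \<Rightarrow> real^2 \<Rightarrow> (real^2) set \<Rightarrow> real^2 \<Rightarrow> real" where
  "nonlocal_curvature \<sigma> z C u = (THE k. has_nonlocal_curvature \<sigma> z C u k)"

lemma has_pv_curvature_unique:
  "has_pv_curvature \<sigma> z C u k \<Longrightarrow> has_pv_curvature \<sigma> z C u l \<Longrightarrow> k = l"
  unfolding has_pv_curvature_def
  by (elim conjE) (rule tendsto_unique[OF trivial_limit_at_right_real])

lemma has_nonlocal_curvature_unique: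
  assumes "has_nonlocal_curvature \<sigma> z C u k" "has_nonlocal_curvature \<sigma> z C u l"
  shows "k = l"
proof (cases "z \<in> C")
  case True
  then show ?thesis
    using assms has_pv_curvature_unique by (auto simp: has_nonlocal_curvature_def)
next
  case False
  let ?C = "\<lambda>\<delta>. C \<union> closed_segment (z - \<delta> *\<^sub>R rot_cw u) (z + \<delta> *\<^sub>R rot_cw u)"
  obtain K L where
    K: "\<forall>\<^sub>F \<delta> in at_right 0. has_pv_curvature \<sigma> z (?C \<delta>) u (K \<delta>)" "(K \<longlongrightarrow> k) (at_right 0)" and
    L: "\<forall>\<^sub>F \<delta> in at_right 0. has_pv_curvature \<sigma> z (?C \<delta>) u (L \<delta>)" "(L \<longlongrightarrow> l) (at_right 0)"
    using assms False by (auto simp: has_nonlocal_curvature_def)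
  have "\<forall>\<^sub>F \<delta> in at_right 0. K \<delta> = L \<delta>"
    using K(1) L(1) by eventually_elim (rule has_pv_curvature_unique)
  then have "(L \<longlongrightarrow> k) (at_right 0)"
    using K(2) by (rule Lim_transform_eventually[rotated])
  then show ?thesis
    using L(2) by (rule tendsto_unique[OF trivial_limit_at_right_real])
qed

lemma nonlocal_curvature_eqI:
  "has_nonlocal_curvature \<sigma> z C u k \<Longrightarrow> nonlocal_curvature \<sigma> z C u = k"
  unfolding nonlocal_curvature_def
  by (rule the_equality) (assumption, erule (1) has_nonlocal_curvature_unique)

section \<open>Layers of a curve seen from a point\<close>

text \<open>For \<open>n \<ge> 1\<close>, \<open>card \<dots> = n\<close> includes finiteness of the intersection.\<close>

definition layer :: "(real^2) set \<Rightarrow> real^2 \<Rightarrow> nat \<Rightarrow> (real^2) set" where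
  "layer C z n =
     {p\<in>C. card ({t *\<^sub>R p + (1 - t) *\<^sub>R z | t :: real. t \<in> {0<..1}} \<inter> C) = n}"

text \<open>
  Absolute convergence, near \<open>z\<close>, of the part of the curvature integral that \<open>S\<close> contributes.
  For a layer \<open>S\<close> of a curve it always holds if \<open>z\<close> has positive distance from \<open>S\<close>, and in
  particular if the layer is empty.

  It is needed for one layer of a curve, to interchange the principal value limit with the sum
  over the layers: existence of all the curvatures involved is not sufficient.  For \<open>z = 0\<close>,
  \<open>u\<close> vertical and disjoint closed angular sectors of width \<open>2\<^sup>-\<^sup>k\<close> (\<open>k = 1, 2, \<dots>\<close>) in the upper
  half-plane, put the same \<open>2k\<close> arcs of circles about \<open>0\<close> in the \<open>k\<close>-th sector and in its
  reflection through \<open>0\<close>, and in the sector itself two further arcs outside these, with radii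
  \<open>r < r'\<close> such that \<open>2\<^sup>-\<^sup>k r\<^sup>-\<^sup>\<sigma> = 1\<close> and \<open>2\<^sup>-\<^sup>k r'\<^sup>-\<^sup>\<sigma> = 1 - 2\<^sup>-\<^sup>k\<close>.  The curvatures of the whole
  curve, of all its layers and of their finite unions exist, but those of the layers do not
  tend to \<open>0\<close>.
\<close>

definition kernel_integrable :: "real \<Rightarrow> real^2 \<Rightarrow> (real^2) set \<Rightarrow> bool" where
  "kernel_integrable \<sigma> z S \<longleftrightarrow>
     set_integrable lebesgue {y. (z, y) \<in> crossing_pairs S} (\<lambda>y. 1 / norm (z - y) powr (2 + \<sigma>))"

end

theory Submission
  imports Defs
begin

text \<open>
  By Sard's theorem almost every ray from \<open>z\<close> is transversal to \<open>C\<close>, and by finiteness of the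
  length it almost surely hits \<open>C\<close> only finitely often away from \<open>z\<close>.  On such a ray the \<open>n\<close>-th
  layer is the \<open>n\<close>-th hit (and no layer meets a ray whose hits accumulate at \<open>z\<close>), so with \<open>h\<close> the
  number of hits between \<open>z\<close> and \<open>y\<close>, crossing the \<open>n\<close>-th layer means \<open>n \<le> h\<close> and crossing the
  first \<open>N\<close> layers means that \<open>min N h\<close> is odd, whose indicator is the alternating sum of those of
  \<open>n \<le> h\<close> over \<open>n \<le> N\<close>.  After removing the half-plane part of the integrand, which is odd about
  \<open>z\<close>, this gives the statement for finite unions by linearity.  The difference of two partial sums
  beyond the \<open>m\<close>-th layer is supported where the \<open>m\<close>-th layer is crossed, hence dominated by an
  integrable function, and dominated convergence gives the limit.
\<close>

section \<open>Principal values\<close>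

text \<open>The delicate point is measurability: a layer is cut out of \<open>C\<close> by counting,
  and its definition alone does not show that the set of \<open>y\<close> crossing it is measurable.
  If \<open>z\<close> lies in the closure of \<open>C\<close>, measurability is extracted from the
  assumed curvatures of the layers, since \<open>has_pv_curvature\<close> contains integrability off
  every ball; it passes to finite unions and to \<open>C\<close> through almost everywhere
  identities and limits, Lebesgue measure being complete. If \<open>z\<close> is off the closure, it
  comes from \<open>C\<close> being a countable union of compact sets. One layer with integrable
  kernel controls all later ones because the sets of \<open>y\<close> with at least \<open>n\<close>
  hits shrink as \<open>n\<close> grows. The earlier layers may converge only as principal values,
  so domination is applied to differences in which they cancel.\<close>

lemma tangent_cone_mono: "S \<subseteq> T \<Longrightarrow> tangent_cone S p \<subseteq> tangent_cone T p"
  unfolding tangent_cone_def by blast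

text \<open>The tangent cone depends only on points arbitrarily close to \<open>p\<close>, and the
  closed set \<open>T\<close> has none there: a witnessing sequence visits \<open>T\<close> only
  finitely often and can be shifted past these visits.\<close>

lemma tangent_cone_Un_closed:
  assumes "closed T" "p \<notin> T"
  shows "tangent_cone (S \<union> T) p = tangent_cone S p"
proof
  show "tangent_cone S p \<subseteq> tangent_cone (S \<union> T) p"
    by (rule tangent_cone_mono) simp
  show "tangent_cone (S \<union> T) p \<subseteq> tangent_cone S p"
  proof
    fix v assume "v \<in> tangent_cone (S \<union> T) p"
    then obtain q c where q: "\<And>k::nat. q k \<in> S \<union> T" "\<And>k. 0 < c k" "q \<longlonglongrightarrow> p"
      and v: "(\<lambda>k. c k *\<^sub>R (q k - p)) \<longlonglongrightarrow> v"
      by (auto simp: tangent_cone_def)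
    have "\<forall>\<^sub>F k in sequentially. q k \<in> - T"
      using topological_tendstoD[OF q(3), of "- T"] assms by (simp add: open_Compl)
    then obtain N where N: "\<And>k. k \<ge> N \<Longrightarrow> q k \<in> - T"
      by (auto simp: eventually_sequentially)
    show "v \<in> tangent_cone S p"
      unfolding tangent_cone_def mem_Collect_eq
      by (rule exI[of _ "\<lambda>k. q (k + N)"], rule exI[of _ "\<lambda>k. c (k + N)"])
        (use q N v le_add2 in \<open>fastforce intro: LIMSEQ_ignore_initial_segment\<close>)
  qed
qed

text \<open>Layers and their unions need not be manifolds. Through tangent cones they inherit
  transversality from \<open>C\<close>, so Sard's theorem is applied to \<open>C\<close>
  alone.\<close>

lemma transversal_subset: "transversal x y T \<Longrightarrow> S \<subseteq> T \<Longrightarrow> transversal x y S"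
  unfolding transversal_def using tangent_cone_mono by blast

text \<open>The added segment lies on the line through \<open>z\<close> orthogonal to
  \<open>u\<close>. A segment from \<open>z\<close> to a point \<open>y\<close> off that line meets
  the line only in its excluded end \<open>z\<close>.\<close>

lemma crossing_pairs_Un_segment:
  assumes "u \<bullet> w = 0" "(z - y) \<bullet> u \<noteq> 0"
  shows "(z, y) \<in> crossing_pairs (S \<union> closed_segment (z - \<delta> *\<^sub>R w) (z + \<delta> *\<^sub>R w))
    \<longleftrightarrow> (z, y) \<in> crossing_pairs S"
proof -
  let ?T = "closed_segment (z - \<delta> *\<^sub>R w) (z + \<delta> *\<^sub>R w)"
  have T: "(x - z) \<bullet> u = 0" if "x \<in> ?T" for x
  proof -
    obtain t where "x = (1 - t) *\<^sub>R (z - \<delta> *\<^sub>R w) + t *\<^sub>R (z + \<delta> *\<^sub>R w)"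
      using \<open>x \<in> ?T\<close> unfolding in_segment by blast
    then have "(x - z) \<bullet> u = ((1 - t) *\<^sub>R (z - \<delta> *\<^sub>R w) + t *\<^sub>R (z + \<delta> *\<^sub>R w) - z) \<bullet> u"
      by (rule arg_cong)
    moreover have "w \<bullet> u = 0" using assms(1) by (simp add: inner_commute)
    ultimately have "(x - z) \<bullet> u = (1 - t) * (z \<bullet> u) + t * (z \<bullet> u) - z \<bullet> u"
      by (simp only: inner_add_left inner_diff_left inner_scaleR_left mult_zero_right diff_0_right add_0_right)
    then show ?thesis by (simp add: algebra_simps)
  qed
  have seg: "(x - z) \<bullet> u \<noteq> 0" if "x \<in> open_segment z y" for x
  proof -
    obtain t where "0 < t" "x = (1 - t) *\<^sub>R z + t *\<^sub>R y"
      using \<open>x \<in> open_segment z y\<close> unfolding in_segment by blast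
    then have "x - z = (- t) *\<^sub>R (z - y)" by (simp add: algebra_simps)
    then show ?thesis using assms(2) \<open>0 < t\<close> by simp
  qed
  have disj: "x \<notin> ?T" if "x \<in> open_segment z y" for x
    using T seg that by blast
  then have "(S \<union> ?T) \<inter> open_segment z y = S \<inter> open_segment z y" by blast
  moreover have "transversal z y (S \<union> ?T) \<longleftrightarrow> transversal z y S"
    using disj unfolding transversal_def
    by (auto simp: tangent_cone_Un_closed[OF closed_segment])
  ultimately show ?thesis by (simp add: crossing_pairs_def)
qed

lemma inner_rot_cw: "u \<bullet> rot_cw u = 0"
  by (simp add: rot_cw_def inner_vec_def sum_2)

text \<open>Separates the half-plane sign, common to all \<open>S\<close>, from the crossing
  indicator, the only factor that depends on \<open>S\<close>. On the boundary line both sides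
  vanish because \<open>sgn 0 = 0\<close>.\<close>

lemma chi_hat_eq:
  "chi_hat S u z y = sgn ((z - y) \<bullet> u) * (1 - 2 * indicator {y. (z, y) \<in> crossing_pairs S} y)"
  unfolding chi_hat_def int_region_def ext_region_def by (auto simp: indicator_def sgn_if)

lemma chi_hat_Un_segment:
  "chi_hat (S \<union> closed_segment (z - \<delta> *\<^sub>R rot_cw u) (z + \<delta> *\<^sub>R rot_cw u)) u z = chi_hat S u z"
proof
  fix y
  show "chi_hat (S \<union> closed_segment (z - \<delta> *\<^sub>R rot_cw u) (z + \<delta> *\<^sub>R rot_cw u)) u z y = chi_hat S u z y"
    using crossing_pairs_Un_segment[OF inner_rot_cw, of z y u S \<delta>]
    by (cases "(z - y) \<bullet> u = 0") (auto simp: chi_hat_eq indicator_def)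
qed

text \<open>The auxiliary segment only affects the null set of \<open>y\<close> on the line through \<open>z\<close> normal to
  \<open>u\<close>, where \<open>chi_hat\<close> vanishes anyway.\<close>

lemma has_nonlocal_curvature_iff_pv:
  "has_nonlocal_curvature \<sigma> z S u k \<longleftrightarrow> has_pv_curvature \<sigma> z S u k"
proof (cases "z \<in> S")
  case True
  then show ?thesis by (simp add: has_nonlocal_curvature_def)
next
  case False
  have *: "has_pv_curvature \<sigma> z (S \<union> closed_segment (z - \<delta> *\<^sub>R rot_cw u) (z + \<delta> *\<^sub>R rot_cw u)) u l
    \<longleftrightarrow> has_pv_curvature \<sigma> z S u l" for \<delta> l
    by (simp add: has_pv_curvature_def chi_hat_Un_segment)
  show ?thesis
  proof
    assume "has_nonlocal_curvature \<sigma> z S u k"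
    then obtain K where K: "\<forall>\<^sub>F \<delta> in at_right 0. has_pv_curvature \<sigma> z S u (K \<delta>)"
      and lim: "(K \<longlongrightarrow> k) (at_right (0::real))"
      using False by (auto simp: has_nonlocal_curvature_def *)
    obtain \<delta> where \<delta>: "has_pv_curvature \<sigma> z S u (K \<delta>)"
      using eventually_happens'[OF trivial_limit_at_right_real K] by blast
    have "\<forall>\<^sub>F d in at_right 0. K d = K \<delta>"
      using K by eventually_elim (use \<delta> has_pv_curvature_unique in blast)
    then have "(K \<longlongrightarrow> K \<delta>) (at_right 0)" by (rule tendsto_eventually)
    then have "k = K \<delta>"
      using lim tendsto_unique trivial_limit_at_right_real by blast
    then show "has_pv_curvature \<sigma> z S u k" using \<delta> by simp
  next
    assume "has_pv_curvature \<sigma> z S u k"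
    then show "has_nonlocal_curvature \<sigma> z S u k"
      using False by (auto simp: has_nonlocal_curvature_def * intro!: exI[of _ "\<lambda>_. k"])
  qed
qed

section \<open>Integrability of the kernel off a ball, and cancellation of odd integrands\<close>

lemma integrable_powr_outside_ball:
  fixes z :: "'a::euclidean_space"
  assumes "real DIM('a) < a" "0 < r"
  shows "set_integrable lebesgue (- ball z r) (\<lambda>y. 1 / norm (z - y) powr a)"
proof -
  let ?n = "DIM('a)"
  define f where "f y = indicator (- ball z r) y * (1 / norm (z - y) powr a)" for y
  have f[measurable]: "f \<in> borel_measurable borel" unfolding f_def by measurable
  \<comment> \<open>Dyadic radii: where \<open>R k \<le> norm (z - y) \<le> R (Suc k)\<close> the
    kernel is at most \<open>c k\<close>, while the volume of \<open>B k\<close> grows like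
    \<open>R k ^ ?n\<close>. The terms form a geometric series with ratio
    \<open>2 powr (real ?n - a)\<close>, which is below 1.\<close>
  define R where "R j = 2 ^ j * r" for j :: nat
  define B where "B j = cball z (R (Suc j))" for j
  have B_meas[measurable]: "B j \<in> sets borel" for j by (simp add: B_def)
  define V where "V = unit_ball_vol (real ?n)"
  define c where "c j = 1 / R j powr a" for j
  have Rpos: "R j > 0" for j using assms by (simp add: R_def)
  have le: "ennreal (f y) \<le> (\<Sum>j. ennreal (c j) * indicator (B j) y)" for y
  proof (cases "norm (z - y) < r")
    case True
    then have "f y = 0" by (simp add: f_def dist_norm)
    then show ?thesis by simp
  next
    case False
    obtain N where N: "norm (z - y) / r < 2 ^ N"
      using real_arch_pow[of 2 "norm (z - y) / r"] by auto
    \<comment> \<open>Minimality of \<open>k\<close> gives the lower bound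
      \<open>R k \<le> norm (z - y)\<close>; for \<open>k = 0\<close> that bound is the assumption
      that \<open>y\<close> is outside the ball.\<close>
    define k where "k = (LEAST j. norm (z - y) \<le> R (Suc j))"
    have "norm (z - y) < R N"
      using N assms(2) by (simp add: R_def pos_divide_less_eq)
    also have "R N \<le> R (Suc N)" using assms(2) by (simp add: R_def)
    finally have ex: "norm (z - y) \<le> R (Suc N)" by simp
    then have k: "norm (z - y) \<le> R (Suc k)"
      using LeastI[of "\<lambda>j. norm (z - y) \<le> R (Suc j)" N] by (simp add: k_def)
    have k': "R k \<le> norm (z - y)"
    proof (cases k)
      case 0
      then show ?thesis using False by (simp add: R_def)
    next
      case (Suc i)
      then have "\<not> norm (z - y) \<le> R (Suc i)"
        using not_less_Least[of i "\<lambda>j. norm (z - y) \<le> R (Suc j)"] by (simp add: k_def)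
      then show ?thesis using Suc by simp
    qed
    have "norm (z - y) \<noteq> 0" using k' Rpos[of k] by linarith
    have "f y = 1 / norm (z - y) powr a" using False by (simp add: f_def dist_norm)
    also have "\<dots> \<le> c k" unfolding c_def using k' Rpos[of k] assms \<open>norm (z - y) \<noteq> 0\<close>
      by (intro divide_left_mono powr_mono2 mult_pos_pos) (auto simp: powr_gt_zero)
    finally have "ennreal (f y) \<le> ennreal (c k)" by (rule ennreal_leI)
    also have "\<dots> = (\<Sum>j\<in>{k}. ennreal (c j) * indicator (B j) y)"
      using k by (simp add: B_def dist_norm)
    also have "\<dots> \<le> (\<Sum>j. ennreal (c j) * indicator (B j) y)"
      by (rule sum_le_suminf) auto
    finally show ?thesis .
  qed
  have em: "emeasure lborel (B j) = ennreal (V * R (Suc j) ^ ?n)" for j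
    using emeasure_cball[of "R (Suc j)" z] less_imp_le[OF Rpos] by (simp only: B_def V_def)
  have eq: "c j * (V * R (Suc j) ^ ?n) = (V * 2 ^ ?n * r powr (real ?n - a)) * (2 powr (real ?n - a)) ^ j" for j
  proof -
    have "c j * (V * R (Suc j) ^ ?n) = V * 2 ^ ?n * (R j powr real ?n / R j powr a)"
    proof -
      have "R (Suc j) = 2 * R j" by (simp add: R_def)
      then have "R (Suc j) ^ ?n = 2 ^ ?n * R j powr real ?n"
        by (simp only: power_mult_distrib powr_realpow[OF Rpos])
      then show ?thesis by (simp add: c_def)
    qed
    also have "R j powr real ?n / R j powr a = (2 ^ j * r) powr (real ?n - a)"
      by (simp add: powr_diff R_def)
    also have "\<dots> = (2 ^ j) powr (real ?n - a) * r powr (real ?n - a)"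
      using assms by (simp add: powr_mult)
    also have "(2 ^ j :: real) powr (real ?n - a) = (2 powr (real ?n - a)) ^ j"
    proof -
      have "(2 ^ j :: real) powr (real ?n - a) = (2 powr real j) powr (real ?n - a)"
        by (subst powr_realpow) auto
      also have "\<dots> = (2 powr (real ?n - a)) powr real j"
        by (simp only: powr_powr mult.commute)
      also have "\<dots> = (2 powr (real ?n - a)) ^ j"
        by (subst powr_realpow) auto
      finally show ?thesis .
    qed
    finally show ?thesis by (simp only: mult_ac)
  qed
  have "(\<integral>\<^sup>+ y. ennreal (f y) \<partial>lborel) \<le> (\<integral>\<^sup>+ y. (\<Sum>j. ennreal (c j) * indicator (B j) y) \<partial>lborel)"
    by (intro nn_integral_mono le)
  also have "\<dots> = (\<Sum>j. \<integral>\<^sup>+ y. ennreal (c j) * indicator (B j) y \<partial>lborel)"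
    by (rule nn_integral_suminf) measurable
  also have "\<dots> = (\<Sum>j. ennreal (c j * (V * R (Suc j) ^ ?n)))"
  proof -
    have "(\<integral>\<^sup>+ y. ennreal (c j) * indicator (B j) y \<partial>lborel) = ennreal (c j * (V * R (Suc j) ^ ?n))" for j
    proof -
      have "(\<integral>\<^sup>+ y. ennreal (c j) * indicator (B j) y \<partial>lborel) = ennreal (c j) * emeasure lborel (B j)"
        by (rule nn_integral_cmult_indicator) simp
      moreover have "0 \<le> c j" by (simp add: c_def)
      ultimately show ?thesis by (simp only: em ennreal_mult')
    qed
    then show ?thesis by simp
  qed
  also have "\<dots> < \<infinity>"
  proof -
    have "2 powr (real ?n - a) < 1" using assms by (simp add: powr_less_one)
    then have "summable (\<lambda>j. (V * 2 ^ ?n * r powr (real ?n - a)) * (2 powr (real ?n - a)) ^ j)"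
      by (intro summable_mult summable_geometric) simp
    then show ?thesis unfolding eq
      by (subst suminf_ennreal2) (auto simp: V_def intro!: mult_nonneg_nonneg)
  qed
  finally have "(\<integral>\<^sup>+ y. ennreal (f y) \<partial>lborel) < \<infinity>" .
  then have "integrable lborel f"
    by (intro integrableI_nonneg) (auto simp: f_def)
  then have "integrable lebesgue f"
    by (simp add: integrable_completion)
  then show ?thesis unfolding set_integrable_def f_def by simp
qed

text \<open>Reflection at \<open>z\<close> preserves Lebesgue measure, so the integral equals its
  own negative. The argument also covers the default value 0 at a non-integrable
  \<open>f\<close>.\<close>

lemma integral_odd_about_eq_0:
  fixes f :: "'a::euclidean_space \<Rightarrow> real"
  assumes [measurable]: "f \<in> borel_measurable borel" and odd: "\<And>y. f (2 *\<^sub>R z - y) = - f y"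
  shows "integral\<^sup>L lebesgue f = 0"
proof -
  have "integral\<^sup>L lborel f = integral\<^sup>L (distr lborel borel (\<lambda>x. 2 *\<^sub>R z + (-1) *\<^sub>R x)) f"
    using lborel_affine[of "-1" "2 *\<^sub>R z"] by (simp add: density_1)
  also have "\<dots> = integral\<^sup>L lborel (\<lambda>x. f (2 *\<^sub>R z - x))"
    by (subst integral_distr) auto
  also have "\<dots> = - integral\<^sup>L lborel f" by (simp add: odd)
  finally show ?thesis by (simp add: integral_completion)
qed

text \<open>What is left of half the integrand without its half-plane part: the indicator has the
  factor -2 in \<open>chi_hat_eq\<close>, whose 2 cancels the 1/2 of the curvature and whose sign
  turns \<open>z - y\<close> into \<open>y - z\<close>. The density is linear in the indicator,
  which makes curvatures additive.\<close>

definition crossing_density :: "real \<Rightarrow> real^2 \<Rightarrow> real^2 \<Rightarrow> (real^2) set \<Rightarrow> real^2 \<Rightarrow> real" where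
  "crossing_density \<sigma> z u S y =
     sgn ((y - z) \<bullet> u) * indicator {y. (z, y) \<in> crossing_pairs S} y / norm (z - y) powr (2 + \<sigma>)"

lemma crossing_density_self [simp]: "crossing_density \<sigma> z u S z = 0"
  by (simp add: crossing_density_def)

text \<open>The half-plane part of \<open>chi_hat\<close> is odd about \<open>z\<close>, so it drops out of the principal value.\<close>

lemma has_pv_curvature_iff:
  assumes "0 < \<sigma>"
  shows "has_pv_curvature \<sigma> z S u k \<longleftrightarrow>
    (\<forall>\<epsilon>>0. set_integrable lebesgue (- ball z \<epsilon>) (crossing_density \<sigma> z u S)) \<and>
    ((\<lambda>\<epsilon>. set_lebesgue_integral lebesgue (- ball z \<epsilon>) (crossing_density \<sigma> z u S)) \<longlongrightarrow> k) (at_right 0)"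
proof -
  let ?f = "\<lambda>y. chi_hat S u z y / norm (z - y) powr (2 + \<sigma>)"
  let ?g = "crossing_density \<sigma> z u S"
  define h where "h y = sgn ((z - y) \<bullet> u) / norm (z - y) powr (2 + \<sigma>)" for y
  have f: "?f y = h y + 2 * ?g y" for y
  proof -
    have "sgn ((y - z) \<bullet> u) = - sgn ((z - y) \<bullet> u)"
      by (metis inner_minus_left minus_diff_eq sgn_minus)
    then show ?thesis
      by (simp add: chi_hat_eq crossing_density_def h_def diff_divide_distrib right_diff_distrib)
  qed
  have h_meas: "h \<in> borel_measurable borel"
    unfolding h_def by measurable
  have h_int: "set_integrable lebesgue (- ball z \<epsilon>) h" if "\<epsilon> > 0" for \<epsilon>
  proof (rule set_integrable_bound[OF integrable_powr_outside_ball[of "2 + \<sigma>" \<epsilon> z]])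
    show "set_borel_measurable lebesgue (- ball z \<epsilon>) h"
      unfolding set_borel_measurable_def
      using h_meas by (intro borel_measurable_scaleR borel_measurable_indicator measurable_completion) auto
    show "AE x in lebesgue. x \<in> - ball z \<epsilon> \<longrightarrow> norm (h x) \<le> norm (1 / norm (z - x) powr (2 + \<sigma>))"
      by (intro always_eventually) (auto simp: h_def sgn_if divide_right_mono)
  qed (use assms that in auto)
  have h0: "set_lebesgue_integral lebesgue (- ball z \<epsilon>) h = 0" for \<epsilon>
    unfolding set_lebesgue_integral_def
  proof (rule integral_odd_about_eq_0)
    show "(\<lambda>y. indicat_real (- ball z \<epsilon>) y *\<^sub>R h y) \<in> borel_measurable borel"
      using h_meas by measurable
    fix y
    have "z - (2 *\<^sub>R z - y) = - (z - y)" by (simp add: scaleR_2)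
    then have "h (2 *\<^sub>R z - y) = - h y" "dist z (2 *\<^sub>R z - y) = dist z y"
      by (simp_all only: h_def dist_norm norm_minus_cancel inner_minus_left sgn_minus minus_divide_left)
    then show "indicat_real (- ball z \<epsilon>) (2 *\<^sub>R z - y) *\<^sub>R h (2 *\<^sub>R z - y) = - (indicat_real (- ball z \<epsilon>) y *\<^sub>R h y)"
      by (simp add: indicator_def)
  qed
  have iff: "set_integrable lebesgue (- ball z \<epsilon>) ?f \<longleftrightarrow> set_integrable lebesgue (- ball z \<epsilon>) ?g"
    if "\<epsilon> > 0" for \<epsilon>
  proof
    assume "set_integrable lebesgue (- ball z \<epsilon>) ?f"
    then have "set_integrable lebesgue (- ball z \<epsilon>) (\<lambda>y. (?f y - h y) * (1 / 2))"
      using h_int[OF that] by (intro set_integrable_mult_left set_integral_diff(1))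
    then show "set_integrable lebesgue (- ball z \<epsilon>) ?g" by (simp add: f)
  next
    assume "set_integrable lebesgue (- ball z \<epsilon>) ?g"
    then have "set_integrable lebesgue (- ball z \<epsilon>) (\<lambda>y. h y + 2 * ?g y)"
      using h_int[OF that] by (intro set_integrable_mult_right set_integral_add(1))
    then show "set_integrable lebesgue (- ball z \<epsilon>) ?f" by (simp add: f)
  qed
  have eq: "1 / 2 * set_lebesgue_integral lebesgue (- ball z \<epsilon>) ?f
      = set_lebesgue_integral lebesgue (- ball z \<epsilon>) ?g"
    if "\<epsilon> > 0" "set_integrable lebesgue (- ball z \<epsilon>) ?g" for \<epsilon>
  proof -
    have "set_lebesgue_integral lebesgue (- ball z \<epsilon>) ?f
        = set_lebesgue_integral lebesgue (- ball z \<epsilon>) h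
        + set_lebesgue_integral lebesgue (- ball z \<epsilon>) (\<lambda>y. 2 * ?g y)"
      unfolding f using that h_int by (intro set_integral_add(2) set_integrable_mult_right)
    then show ?thesis by (simp add: h0)
  qed
  show ?thesis
  proof (cases "\<forall>\<epsilon>>0. set_integrable lebesgue (- ball z \<epsilon>) ?g")
    case True
    then have ev: "\<forall>\<^sub>F \<epsilon> in at_right 0. 1 / 2 * set_lebesgue_integral lebesgue (- ball z \<epsilon>) ?f
      = set_lebesgue_integral lebesgue (- ball z \<epsilon>) ?g"
      using eq by (auto simp: eventually_at_filter)
    show ?thesis unfolding has_pv_curvature_def
      using True iff tendsto_cong[OF ev] by blast
  next
    case False
    then show ?thesis unfolding has_pv_curvature_def using iff by blast
  qed
qed

text \<open>For an integrable function the principal value is the ordinary integral, by dominated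
  convergence with majorant \<open>norm (f x)\<close>. The condition at \<open>z\<close> makes the
  pointwise limit valid at the centre too.\<close>

lemma tendsto_integral_outside_ball:
  fixes f :: "'a::euclidean_space \<Rightarrow> real"
  assumes f: "integrable lebesgue f" and "f z = 0"
  shows "((\<lambda>\<epsilon>. set_lebesgue_integral lebesgue (- ball z \<epsilon>) f) \<longlongrightarrow> integral\<^sup>L lebesgue f) (at_right 0)"
  unfolding tendsto_at_iff_sequentially comp_def
proof (intro allI impI)
  fix X :: "nat \<Rightarrow> real"
  assume "\<forall>i. X i \<in> {0<..} - {0}" and lim: "X \<longlonglongrightarrow> 0"
  show "(\<lambda>i. set_lebesgue_integral lebesgue (- ball z (X i)) f) \<longlonglongrightarrow> integral\<^sup>L lebesgue f"
    unfolding set_lebesgue_integral_def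
  proof (rule integral_dominated_convergence[where w = "\<lambda>x. norm (f x)"])
    show "f \<in> borel_measurable lebesgue" using f by simp
    then show "(\<lambda>x. indicat_real (- ball z (X i)) x *\<^sub>R f x) \<in> borel_measurable lebesgue" for i
      by (intro borel_measurable_scaleR borel_measurable_indicator) auto
    show "integrable lebesgue (\<lambda>x. norm (f x))" using f by simp
    show "AE x in lebesgue. norm (indicat_real (- ball z (X i)) x *\<^sub>R f x) \<le> norm (f x)" for i
      by (auto simp: indicator_def)
    show "AE x in lebesgue. (\<lambda>i. indicat_real (- ball z (X i)) x *\<^sub>R f x) \<longlonglongrightarrow> f x"
    proof (intro always_eventually allI)
      fix x
      show "(\<lambda>i. indicat_real (- ball z (X i)) x *\<^sub>R f x) \<longlonglongrightarrow> f x"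
      proof (cases "x = z")
        case False
        then have "\<forall>\<^sub>F i in sequentially. X i < dist z x"
          using order_tendstoD(2)[OF lim, of "dist z x"] by simp
        then have "\<forall>\<^sub>F i in sequentially. indicat_real (- ball z (X i)) x *\<^sub>R f x = f x"
          by eventually_elim simp
        then show ?thesis by (rule tendsto_eventually)
      qed (use assms in simp)
    qed
  qed
qed

text \<open>\<open>f\<close> is the pointwise limit of its truncations. Applied to crossing
  densities, this turns the integrability clause of \<open>has_pv_curvature\<close> into
  measurability on the whole plane.\<close>

lemma borel_measurable_of_outside_balls:
  fixes f :: "'a::euclidean_space \<Rightarrow> real"
  assumes f: "\<And>\<epsilon>. \<epsilon> > 0 \<Longrightarrow> set_integrable lebesgue (- ball z \<epsilon>) f" and "f z = 0"
  shows "f \<in> borel_measurable lebesgue"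
proof (rule borel_measurable_LIMSEQ_metric)
  show "(\<lambda>x. indicat_real (- ball z (inverse (real (Suc i)))) x *\<^sub>R f x) \<in> borel_measurable lebesgue" for i
    using f[of "inverse (real (Suc i))"] by (simp add: set_integrable_def)
  fix x
  show "(\<lambda>i. indicat_real (- ball z (inverse (real (Suc i)))) x *\<^sub>R f x) \<longlonglongrightarrow> f x"
  proof (cases "x = z")
    case False
    then have "\<forall>\<^sub>F i in sequentially. inverse (real (Suc i)) < dist z x"
      using order_tendstoD(2)[OF LIMSEQ_inverse_real_of_nat, of "dist z x"] by simp
    then have "\<forall>\<^sub>F i in sequentially. indicat_real (- ball z (inverse (real (Suc i)))) x *\<^sub>R f x = f x"
      by eventually_elim simp
    then show ?thesis by (rule tendsto_eventually)
  qed (use assms in simp)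
qed

lemma has_pv_curvature_of_integrable:
  assumes "0 < \<sigma>" "integrable lebesgue (crossing_density \<sigma> z u S)"
  shows "has_pv_curvature \<sigma> z S u (integral\<^sup>L lebesgue (crossing_density \<sigma> z u S))"
  unfolding has_pv_curvature_iff[OF assms(1)]
proof (intro conjI allI impI)
  show "set_integrable lebesgue (- ball z \<epsilon>) (crossing_density \<sigma> z u S)" for \<epsilon>
    unfolding set_integrable_def using assms(2)
    by (rule integrable_mult_indicator[rotated]) auto
  show "((\<lambda>\<epsilon>. set_lebesgue_integral lebesgue (- ball z \<epsilon>) (crossing_density \<sigma> z u S)) \<longlongrightarrow>
      integral\<^sup>L lebesgue (crossing_density \<sigma> z u S)) (at_right 0)"
    using assms(2) by (rule tendsto_integral_outside_ball) simp
qed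

section \<open>Transversality of almost every ray\<close>

text \<open>The base point is left out, so that the chart domains form one family of open sets from
  which Lindelof's theorem selects a countable atlas.\<close>

definition C1_chart :: "(real^2) set \<Rightarrow> (real^2) set \<Rightarrow> bool" where
  "C1_chart C U \<longleftrightarrow> open U \<and>
     (\<exists>(I :: real set) \<gamma> \<gamma>' \<tau>. is_interval I \<and> homeomorphism I (C \<inter> U) \<gamma> \<tau> \<and>
        (\<forall>t\<in>I. (\<gamma> has_vector_derivative \<gamma>' t) (at t within I) \<and> \<gamma>' t \<noteq> 0))"

lemma countable_C1_atlas:
  assumes "C1_manifold_1d C"
  obtains \<U> where "countable \<U>" "\<And>U. U \<in> \<U> \<Longrightarrow> C1_chart C U" "C \<subseteq> \<Union>\<U>"
proof -
  obtain \<U> where \<U>: "\<U> \<subseteq> {U. C1_chart C U}" "countable \<U>" "\<Union>\<U> = \<Union>{U. C1_chart C U}"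
    by (rule Lindelof[of "{U. C1_chart C U}"]) (auto simp: C1_chart_def)
  have "C \<subseteq> \<Union>{U. C1_chart C U}"
  proof
    fix p assume "p \<in> C"
    then obtain U I \<gamma> \<gamma>' \<tau> where "open U \<and> p \<in> U \<and> is_interval I \<and> interior I \<noteq> {} \<and>
        homeomorphism I (C \<inter> U) \<gamma> \<tau> \<and>
        (\<forall>t\<in>I. (\<gamma> has_vector_derivative \<gamma>' t) (at t within I) \<and> \<gamma>' t \<noteq> 0) \<and>
        continuous_on I \<gamma>'"
      using assms unfolding C1_manifold_1d_def by meson
    then have "C1_chart C U" "p \<in> U" unfolding C1_chart_def by blast+
    then show "p \<in> \<Union>{U. C1_chart C U}" by blast
  qed
  with \<U> show thesis by (intro that[of \<U>]) auto
qed

text \<open>Sard's theorem for the cone map \<open>(s, t) \<mapsto> z + s (\<gamma> t - z)\<close>, whose derivative degenerates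
  exactly where the ray from \<open>z\<close> is tangent to the curve.\<close>

lemma negligible_tangent_rays:
  fixes \<gamma> :: "real \<Rightarrow> real^2"
  assumes der: "\<And>t. t \<in> I \<Longrightarrow> (\<gamma> has_vector_derivative \<gamma>' t) (at t within I)"
  shows "negligible {z + s *\<^sub>R (\<gamma> t - z) | s t. t \<in> I \<and> \<gamma>' t \<in> span {\<gamma> t - z}}"
proof -
  define S :: "(real^2) set" where "S = {x. x $ 2 \<in> I \<and> \<gamma>' (x $ 2) \<in> span {\<gamma> (x $ 2) - z}}"
  define F where "F x = z + x $ 1 *\<^sub>R (\<gamma> (x $ 2) - z)" for x :: "real^2"
  define F' where "F' x h = x $ 1 *\<^sub>R (h $ 2 *\<^sub>R \<gamma>' (x $ 2)) + h $ 1 *\<^sub>R (\<gamma> (x $ 2) - z)"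
    for x h :: "real^2"
  have F_der: "(F has_derivative F' x) (at x within S)" if "x \<in> S" for x
  proof -
    have 2: "((\<lambda>x::real^2. x $ 2) has_derivative (\<lambda>h. h $ 2)) (at x within S)"
      and 1: "((\<lambda>x::real^2. x $ 1) has_derivative (\<lambda>h. h $ 1)) (at x within S)"
      by (auto intro!: bounded_linear_imp_has_derivative bounded_linear_vec_nth)
    have "(\<gamma> has_derivative (\<lambda>h. h *\<^sub>R \<gamma>' (x $ 2))) (at (x $ 2) within I)"
      using der[of "x $ 2"] that by (simp add: S_def has_vector_derivative_def)
    then have "(\<gamma> has_derivative (\<lambda>h. h *\<^sub>R \<gamma>' (x $ 2))) (at (x $ 2) within (\<lambda>x. x $ 2) ` S)"
      by (rule has_derivative_subset) (auto simp: S_def)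
    from has_derivative_in_compose[OF 2 this]
    have g: "((\<lambda>x. \<gamma> (x $ 2) - z) has_derivative (\<lambda>h. h $ 2 *\<^sub>R \<gamma>' (x $ 2))) (at x within S)"
      using has_derivative_diff[OF _ has_derivative_const] by fastforce
    have "((\<lambda>x. z + x $ 1 *\<^sub>R (\<gamma> (x $ 2) - z)) has_derivative
        (\<lambda>h. 0 + (x $ 1 *\<^sub>R (h $ 2 *\<^sub>R \<gamma>' (x $ 2)) + h $ 1 *\<^sub>R (\<gamma> (x $ 2) - z)))) (at x within S)"
      by (intro has_derivative_add has_derivative_const has_derivative_scaleR 1 g)
    then show ?thesis by (simp add: F_def[abs_def] F'_def[abs_def])
  qed
  have "negligible (F ` S)"
  proof (rule baby_Sard)
    show "(F has_derivative F' x) (at x within S)" if "x \<in> S" for x by (rule F_der[OF that])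
    fix x assume x: "x \<in> S"
    then obtain c where c: "\<gamma>' (x $ 2) = c *\<^sub>R (\<gamma> (x $ 2) - z)"
      by (auto simp: S_def span_singleton)
    have lin: "linear (F' x)" using F_der[OF x] has_derivative_linear by blast
    \<comment> \<open>A kernel vector of the derivative: with \<open>\<gamma>'\<close> equal to
      \<open>c\<close> times \<open>\<gamma> - z\<close>, its two contributions to
      \<open>F' x h\<close> cancel. The entry -1 keeps it nonzero even if \<open>c\<close> or
      \<open>x $ 1\<close> vanishes.\<close>
    define h :: "real^2" where "h = vector [x $ 1 * c, - 1]"
    have "F' x h = 0" by (simp add: F'_def h_def c)
    moreover have "h \<noteq> 0" by (metis h_def vector_2(2) zero_index zero_neq_neg_one)
    moreover have "matrix (F' x) *v h = F' x h" "matrix (F' x) *v 0 = 0"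
      using fun_cong[OF matrix_vector_mul(2)[OF lin], of h] by simp_all
    ultimately have "\<not> inj ((*v) (matrix (F' x)))"
      by (auto dest!: injD[of _ h 0])
    then show "rank (matrix (F' x)) < CARD(2)"
      by (simp only: less_rank_noninjective not_False_eq_True)
  qed simp
  moreover have "{z + s *\<^sub>R (\<gamma> t - z) | s t. t \<in> I \<and> \<gamma>' t \<in> span {\<gamma> t - z}} \<subseteq> F ` S"
  proof clarify
    fix s t assume "t \<in> I" "\<gamma>' t \<in> span {\<gamma> t - z}"
    then have "(vector [s, t] :: real^2) \<in> S" "z + s *\<^sub>R (\<gamma> t - z) = F (vector [s, t])"
      by (simp_all add: S_def F_def)
    then show "z + s *\<^sub>R (\<gamma> t - z) \<in> F ` S" by (metis imageI)
  qed
  ultimately show ?thesis by (rule negligible_subset)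
qed

text \<open>If the segment from \<open>z\<close> to \<open>y\<close> is tangent to \<open>C\<close>
  at \<open>p = \<gamma> t\<close>, then \<open>y\<close> is on the ray through \<open>p\<close>, in
  the degenerate image of the cone map with \<open>s = 1 / w\<close>. Countably many charts give a
  null set of such \<open>y\<close>.\<close>

lemma AE_transversal:
  assumes "C1_manifold_1d C"
  shows "AE y in lebesgue. transversal z y C"
proof -
  obtain \<U> where \<U>: "countable \<U>" "\<And>U. U \<in> \<U> \<Longrightarrow> C1_chart C U" "C \<subseteq> \<Union>\<U>"
    using countable_C1_atlas[OF assms] by blast
  define B where "B U = {y. \<exists>p\<in>open_segment z y \<inter> (C \<inter> U). \<exists>v\<in>tangent_cone C p. v \<noteq> 0 \<and> v \<in> span {y - z}}" for U
  have "negligible (B U)" if "U \<in> \<U>" for U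
  proof -
    have "open U" using \<U>(2)[OF that] by (simp add: C1_chart_def)
    obtain I \<gamma> \<gamma>' \<tau> where ch: "is_interval I \<and> homeomorphism I (C \<inter> U) \<gamma> \<tau> \<and>
        (\<forall>t\<in>I. (\<gamma> has_vector_derivative \<gamma>' t) (at t within I) \<and> \<gamma>' t \<noteq> 0)"
      using \<U>(2)[OF \<open>U \<in> \<U>\<close>] unfolding C1_chart_def by blast
    then have hom: "homeomorphism I (C \<inter> U) \<gamma> \<tau>"
      and der: "\<And>t. t \<in> I \<Longrightarrow> (\<gamma> has_vector_derivative \<gamma>' t) (at t within I)"
      and nz: "\<And>t. t \<in> I \<Longrightarrow> \<gamma>' t \<noteq> 0"
      by simp_all
    have "B U \<subseteq> {z + s *\<^sub>R (\<gamma> t - z) | s t. t \<in> I \<and> \<gamma>' t \<in> span {\<gamma> t - z}}"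
    proof
      fix y assume "y \<in> B U"
      then obtain p v where p: "p \<in> open_segment z y" "p \<in> C \<inter> U"
        and v: "v \<in> tangent_cone C p" "v \<noteq> 0" "v \<in> span {y - z}"
        unfolding B_def by blast
      obtain t where t: "t \<in> I" "p = \<gamma> t"
        using p(2) homeomorphism_image1[OF hom] by blast
      obtain w where w: "0 < w" "p = (1 - w) *\<^sub>R z + w *\<^sub>R y"
        using p(1) unfolding in_segment by blast
      have pz: "p - z = w *\<^sub>R (y - z)" using w(2) by (simp add: algebra_simps)
      then have "(1 / w) *\<^sub>R (p - z) = y - z" using w(1) by simp
      then have y: "y = z + (1 / w) *\<^sub>R (\<gamma> t - z)" by (simp add: t(2))
      have "v \<in> span {\<gamma>' t}"
        using tangent_cone_C1_subset[OF hom \<open>open U\<close> t(1) der[OF t(1)] nz[OF t(1)]] v(1) t(2) by auto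
      then obtain a where a: "v = a *\<^sub>R \<gamma>' t" by (auto simp: span_singleton)
      obtain b where b: "v = b *\<^sub>R (y - z)" using v(3) by (auto simp: span_singleton)
      have "a \<noteq> 0" using a v(2) by auto
      then have "\<gamma>' t = (1 / a) *\<^sub>R v" using a by simp
      also have "\<dots> = (b / a / w) *\<^sub>R (p - z)" using b pz w(1) by simp
      finally have "\<gamma>' t \<in> span {\<gamma> t - z}" using t(2) by (simp add: span_base span_scale)
      then show "y \<in> {z + s *\<^sub>R (\<gamma> t - z) | s t. t \<in> I \<and> \<gamma>' t \<in> span {\<gamma> t - z}}"
        using y t(1) by blast
    qed
    with negligible_tangent_rays[OF der] show ?thesis by (rule negligible_subset)
  qed
  then have "negligible (\<Union>(B ` \<U>))"
    using \<U>(1) by (intro negligible_countable_Union) auto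
  then have "\<Union>(B ` \<U>) \<in> null_sets lebesgue" by (simp add: negligible_iff_null_sets)
  moreover have "{y \<in> space lebesgue. \<not> transversal z y C} \<subseteq> \<Union>(B ` \<U>)"
    using \<U>(3) unfolding transversal_def B_def by blast
  ultimately show ?thesis by (rule AE_I')
qed

section \<open>Curves as countable unions of compact sets\<close>

lemma interval_countable_Union_compact:
  fixes I :: "real set"
  assumes "is_interval I"
  obtains \<K> where "countable \<K>" "\<And>K. K \<in> \<K> \<Longrightarrow> compact K" "\<Union>\<K> = I"
proof -
  \<comment> \<open>Rational points of \<open>I\<close> together with those ends that belong to
    \<open>I\<close>, at most one of each kind. Compact intervals with ends in \<open>D\<close>
    exhaust \<open>I\<close>, whether it is open, closed or half-open.\<close>
  define D where "D = (I \<inter> \<rat>) \<union> {x\<in>I. \<forall>y\<in>I. y \<le> x} \<union> {x\<in>I. \<forall>y\<in>I. x \<le> y}"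
  have one: "countable A" if "\<And>x y. x \<in> A \<Longrightarrow> y \<in> A \<Longrightarrow> x = y" for A :: "real set"
  proof (cases "A = {}")
    case False
    then obtain a where "a \<in> A" by blast
    then have "A \<subseteq> {a}" using that by blast
    then show ?thesis by (rule countable_subset) simp
  qed simp
  have "countable {x\<in>I. \<forall>y\<in>I. y \<le> x}" "countable {x\<in>I. \<forall>y\<in>I. x \<le> y}"
    by (rule one, simp add: antisym)+
  then have D: "countable D" "D \<subseteq> I" by (auto simp: D_def intro: countable_subset[OF _ countable_rat])
  have sub: "{a..b} \<subseteq> I" if "a \<in> I" "b \<in> I" for a b
    using that assms by (meson atLeastAtMost_iff mem_is_interval_1_I subsetI)
  have ex: "\<exists>a\<in>D. \<exists>b\<in>D. x \<in> {a..b}" if "x \<in> I" for x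
  proof -
    have "\<exists>a\<in>D. a \<le> x"
    proof (cases "\<forall>y\<in>I. x \<le> y")
      case False
      then obtain y where "y \<in> I" "y < x" by force
      then obtain q where "q \<in> \<rat>" "y < q" "q < x" using Rats_dense_in_real by blast
      moreover from this have "q \<in> I" using sub[OF \<open>y \<in> I\<close> \<open>x \<in> I\<close>] by force
      ultimately show ?thesis by (intro bexI[of _ q]) (auto simp: D_def)
    qed (use that in \<open>auto simp: D_def\<close>)
    moreover have "\<exists>b\<in>D. x \<le> b"
    proof (cases "\<forall>y\<in>I. y \<le> x")
      case False
      then obtain y where "y \<in> I" "x < y" by force
      then obtain q where "q \<in> \<rat>" "x < q" "q < y" using Rats_dense_in_real by blast
      moreover from this have "q \<in> I" using sub[OF \<open>x \<in> I\<close> \<open>y \<in> I\<close>] by force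
      ultimately show ?thesis by (intro bexI[of _ q]) (auto simp: D_def)
    qed (use that in \<open>auto simp: D_def\<close>)
    ultimately show ?thesis by auto
  qed
  show thesis
  proof (rule that[of "(\<lambda>(a, b). {a..b}) ` (D \<times> D)"])
    show "countable ((\<lambda>(a, b). {a..b}) ` (D \<times> D))" using D by blast
    show "\<Union>((\<lambda>(a, b). {a..b}) ` (D \<times> D)) = I" using sub ex D(2) by fastforce
  qed auto
qed

text \<open>Curves may lack endpoints and need not be closed; this is the substitute for compactness
  in the proof that hit counts are Borel.\<close>

lemma C1_manifold_countable_Union_compact:
  assumes "C1_manifold_1d C"
  obtains \<K> where "countable \<K>" "\<And>K. K \<in> \<K> \<Longrightarrow> compact K" "\<Union>\<K> = C"
proof -
  obtain \<U> where \<U>: "countable \<U>" "\<And>U. U \<in> \<U> \<Longrightarrow> C1_chart C U" "C \<subseteq> \<Union>\<U>"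
    using countable_C1_atlas[OF assms] by blast
  have "\<exists>\<K>. countable \<K> \<and> (\<forall>K\<in>\<K>. compact K) \<and> \<Union>\<K> = C \<inter> U" if "U \<in> \<U>" for U
  proof -
    obtain I \<gamma> \<tau> where "is_interval (I :: real set)" and hom: "homeomorphism I (C \<inter> U) \<gamma> \<tau>"
      using \<U>(2)[OF \<open>U \<in> \<U>\<close>] unfolding C1_chart_def by blast
    obtain \<K> where \<K>: "countable \<K>" "\<And>K. K \<in> \<K> \<Longrightarrow> compact K" "\<Union>\<K> = I"
      using interval_countable_Union_compact[OF \<open>is_interval I\<close>] by blast
    have "compact (\<gamma> ` K)" if "K \<in> \<K>" for K
    proof (rule compact_continuous_image)
      show "continuous_on K \<gamma>"
        using hom \<K>(3) that by (auto simp: homeomorphism_def intro: continuous_on_subset)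
    qed (use \<K>(2) that in auto)
    moreover have "\<Union>((`) \<gamma> ` \<K>) = C \<inter> U"
      using homeomorphism_image1[OF hom] \<K>(3) by blast
    ultimately show ?thesis using \<K>(1) by (intro exI[of _ "(`) \<gamma> ` \<K>"]) auto
  qed
  then obtain \<K> where \<K>: "\<And>U. U \<in> \<U> \<Longrightarrow> countable (\<K> U) \<and> (\<forall>K\<in>\<K> U. compact K) \<and> \<Union>(\<K> U) = C \<inter> U"
    by metis
  show thesis
  proof (rule that[of "\<Union>(\<K> ` \<U>)"])
    show "countable (\<Union>(\<K> ` \<U>))" using \<K> \<U>(1) by (intro countable_UN) auto
    show "\<Union>(\<Union>(\<K> ` \<U>)) = C"
    proof -
      have "\<Union>(\<Union>(\<K> ` \<U>)) = (\<Union>U\<in>\<U>. \<Union>(\<K> U))" by blast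
      also have "\<dots> = (\<Union>U\<in>\<U>. C \<inter> U)" using \<K> by simp
      also have "\<dots> = C" using \<U>(3) by blast
      finally show ?thesis .
    qed
  qed (use \<K> in blast)
qed

section \<open>Finiteness of the hits on almost every ray\<close>

lemma norm_rot_cw: "norm (rot_cw v) = norm v"
  by (simp add: rot_cw_def norm_vec_def L2_set_def sum_2 add.commute)

text \<open>An orthogonal map taking the first axis to \<open>w\<close> shows that the set fits into
  a box with sides \<open>2 * c\<close> and \<open>2 * R\<close>.\<close>

lemma emeasure_strip_le:
  fixes w z :: "real^2"
  assumes "norm w = 1" "0 \<le> c" "0 \<le> R"
  shows "emeasure lebesgue {y \<in> cball z R. \<bar>(y - z) \<bullet> w\<bar> \<le> c} \<le> ennreal (4 * c * R)"
proof -
  let ?B = "cbox (vector [- c, - R]) (vector [c, R]) :: (real^2) set"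
  obtain f where f: "orthogonal_transformation f" "f (axis 1 1 :: real^2) = w"
    using orthogonal_transformation_exists_1[of "axis 1 1 :: real^2" w] assms(1) by auto
  have "{y \<in> cball z R. \<bar>(y - z) \<bullet> w\<bar> \<le> c} \<subseteq> (+) z ` f ` ?B"
  proof
    fix y assume y: "y \<in> {y \<in> cball z R. \<bar>(y - z) \<bullet> w\<bar> \<le> c}"
    obtain v where v: "y - z = f v"
      using orthogonal_transformation_surj[OF f(1)] by (metis surjD)
    have "norm v \<le> R" using y v f(1)
      by (simp add: dist_norm norm_minus_commute orthogonal_transformation_norm)
    then have v2: "\<bar>v $ 2\<bar> \<le> R" using component_le_norm_cart[of v 2] by linarith
    have "f v \<bullet> f (axis 1 1) = v \<bullet> axis 1 1"
      using f(1) by (simp add: orthogonal_transformation_def)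
    then have "(y - z) \<bullet> w = v $ 1"
      using f(2) v by (simp add: inner_axis)
    then have v1: "\<bar>v $ 1\<bar> \<le> c" using y by simp
    have "v \<in> ?B" using v1 v2
      by (auto simp: mem_box_cart forall_2 abs_le_iff)
    moreover have "y = z + f v" using v by (simp add: algebra_simps)
    ultimately show "y \<in> (+) z ` f ` ?B" by blast
  qed
  moreover have B: "f ` ?B \<in> lmeasurable" "measure lebesgue (f ` ?B) = measure lebesgue ?B"
    using measurable_orthogonal_image[OF f(1)] measure_orthogonal_image[OF f(1)] by auto
  moreover have B': "(+) z ` f ` ?B \<in> lmeasurable" using B(1) by (rule measurable_translation)
  ultimately have "emeasure lebesgue {y \<in> cball z R. \<bar>(y - z) \<bullet> w\<bar> \<le> c} \<le> emeasure lebesgue ((+) z ` f ` ?B)"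
    by (intro emeasure_mono) auto
  also have "\<dots> = ennreal (measure lebesgue ((+) z ` f ` ?B))"
    using B' by (rule emeasure_eq_measure2)
  also have "measure lebesgue ((+) z ` f ` ?B) = measure lebesgue ?B"
    using B by (simp add: measure_translation)
  also have "measure lebesgue ?B = 4 * c * R"
  proof -
    have "(vector [- c, - R] :: real^2) \<in> ?B"
      using assms by (auto simp: mem_box_cart forall_2)
    then have "?B \<noteq> {}" by blast
    then have "measure lborel ?B = (\<Prod>i\<in>UNIV. vector [c, R] $ i - vector [- c, - R] $ (i::2))"
      by (rule content_cbox_cart)
    also have "\<dots> = 4 * c * R" by (simp add: UNIV_2)
    finally show ?thesis by simp
  qed
  finally show ?thesis .
qed

text \<open>Seen from \<open>z\<close>, a set at distance at least \<epsilon> has angular size of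
  order \<open>diameter E / \<epsilon>\<close>, so inside the ball of radius \<open>R\<close> its
  radial shadow is a thin strip with area linear in the diameter.\<close>

lemma shadow_in_strip:
  fixes E :: "(real^2) set"
  assumes "bounded E" "0 < \<epsilon>" "0 < R"
  obtains T where "T \<in> sets lebesgue" "emeasure lebesgue T \<le> ennreal (4 * R\<^sup>2 / \<epsilon>) * ennreal (diameter E)"
    "\<And>q y. q \<in> E - ball z \<epsilon> \<Longrightarrow> q \<in> open_segment z y \<Longrightarrow> y \<in> ball z R \<Longrightarrow> y \<in> T"
proof (cases "E - ball z \<epsilon> = {}")
  case True
  then show thesis by (intro that[of "{}"]) auto
next
  case False
  then obtain x where "x \<in> E - ball z \<epsilon>" by blast
  then have x: "x \<in> E" "dist z x \<ge> \<epsilon>" by auto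
  define w where "w = rot_cw (x - z) /\<^sub>R norm (x - z)"
  \<comment> \<open>For \<open>q = z + t (y - z)\<close> the distance of \<open>y\<close> from the
    line through \<open>z\<close> and \<open>x\<close>, multiplied by \<open>t\<close>, is at most
    \<open>diameter E\<close>; and \<open>t\<close> is at least \<open>\<epsilon> / R\<close>,
    because \<open>q\<close> is outside the small ball and \<open>y\<close> inside the large
    one.\<close>
  define c where "c = diameter E * R / \<epsilon>"
  define T where "T = {y \<in> cball z R. \<bar>(y - z) \<bullet> w\<bar> \<le> c}"
  have nx: "norm (x - z) > 0" using x(2) \<open>0 < \<epsilon>\<close> by (metis dist_commute dist_norm less_le_trans)
  have w: "norm w = 1" using nx by (simp add: w_def norm_rot_cw)
  have perp: "(x - z) \<bullet> w = 0" by (simp add: w_def inner_rot_cw)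
  have c: "0 \<le> c" using assms diameter_ge_0[OF assms(1)] by (simp add: c_def)
  have "closed T"
  proof -
    have "T = cball z R \<inter> {y. \<bar>(y - z) \<bullet> w\<bar> \<le> c}" by (auto simp: T_def)
    also have "closed \<dots>"
      by (intro closed_Int closed_cball closed_Collect_le continuous_intros)
    finally show ?thesis .
  qed
  show thesis
  proof (rule that[of T])
    show "T \<in> sets lebesgue" using borel_closed[OF \<open>closed T\<close>] by simp
    have "emeasure lebesgue T \<le> ennreal (4 * c * R)"
      unfolding T_def using w c assms(3) by (intro emeasure_strip_le) auto
    also have "4 * c * R = (4 * R\<^sup>2 / \<epsilon>) * diameter E"
      by (simp add: c_def power2_eq_square)
    also have "ennreal \<dots> = ennreal (4 * R\<^sup>2 / \<epsilon>) * ennreal (diameter E)"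
      using assms(2) by (intro ennreal_mult') simp
    finally show "emeasure lebesgue T \<le> ennreal (4 * R\<^sup>2 / \<epsilon>) * ennreal (diameter E)" .
    fix q y assume q: "q \<in> E - ball z \<epsilon>" "q \<in> open_segment z y" and y: "y \<in> ball z R"
    obtain t where t: "0 < t" "q = (1 - t) *\<^sub>R z + t *\<^sub>R y"
      using q(2) unfolding in_segment by blast
    have qz: "q - z = t *\<^sub>R (y - z)" using t(2) by (simp add: algebra_simps)
    have "\<epsilon> \<le> norm (q - z)" using q(1) by (simp add: dist_norm norm_minus_commute)
    also have "\<dots> = t * norm (y - z)" using t(1) qz by simp
    also have "\<dots> \<le> t * R" using y t(1) by (simp add: dist_norm norm_minus_commute)
    finally have tR: "\<epsilon> \<le> t * R" .
    have "t * \<bar>(y - z) \<bullet> w\<bar> = \<bar>(q - z) \<bullet> w\<bar>" using qz t(1) by (simp add: abs_mult)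
    also have "(q - z) \<bullet> w = (q - x) \<bullet> w" using perp by (simp add: inner_diff_left)
    also have "\<bar>(q - x) \<bullet> w\<bar> \<le> norm (q - x)"
      using Cauchy_Schwarz_ineq2[of "q - x" w] w by simp
    also have "\<dots> \<le> diameter E"
      using diameter_bounded_bound[OF assms(1), of q x] q(1) x(1) by (simp add: dist_norm)
    finally have "t * \<bar>(y - z) \<bullet> w\<bar> \<le> diameter E" .
    then have "(t * \<bar>(y - z) \<bullet> w\<bar>) * R \<le> diameter E * R"
      using assms(3) by (intro mult_right_mono) auto
    moreover have "\<epsilon> * \<bar>(y - z) \<bullet> w\<bar> \<le> (t * R) * \<bar>(y - z) \<bullet> w\<bar>"
      using tR by (intro mult_right_mono) auto
    ultimately have "\<epsilon> * \<bar>(y - z) \<bullet> w\<bar> \<le> diameter E * R" by (simp add: mult_ac)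
    then have "\<bar>(y - z) \<bullet> w\<bar> \<le> c" using assms(2) by (simp add: c_def field_simps)
    then show "y \<in> T" using y by (simp add: T_def)
  qed
qed

text \<open>The bound on the total diameter is uniform in the mesh, as Fatou's lemma requires.
  Adding 1 to the finite length makes it exceed the infimum strictly, so an actual cover satisfies
  it.\<close>

lemma curve_length_cover:
  assumes "curve_length C < \<infinity>" "0 < \<delta>"
  obtains E :: "nat \<Rightarrow> (real^2) set" where "C \<subseteq> (\<Union>i. E i)" "\<And>i. bounded (E i)"
    "\<And>i. diameter (E i) \<le> \<delta>" "(\<Sum>i. ennreal (diameter (E i))) \<le> curve_length C + 1"
proof -
  let ?\<E> = "\<lambda>\<delta>. {E :: nat \<Rightarrow> (real^2) set. C \<subseteq> (\<Union>i. E i) \<and> (\<forall>i. bounded (E i) \<and> diameter (E i) \<le> \<delta>)}"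
  have "(INF E\<in>?\<E> \<delta>. \<Sum>i. ennreal (diameter (E i))) \<le> curve_length C"
    unfolding curve_length_def using assms(2)
    by (intro SUP_upper[where f = "\<lambda>\<delta>. INF E\<in>?\<E> \<delta>. \<Sum>i. ennreal (diameter (E i))"]) simp
  also have "curve_length C < curve_length C + 1"
    using assms(1) by (cases "curve_length C") (auto simp flip: ennreal_1 ennreal_plus simp: ennreal_less_iff)
  finally have "\<exists>E\<in>?\<E> \<delta>. (\<Sum>i. ennreal (diameter (E i))) < curve_length C + 1"
    by (simp add: INF_less_iff)
  then show thesis using that less_imp_le by blast
qed

lemma finite_min_dist:
  fixes T :: "'a::metric_space set"
  assumes "finite T"
  obtains \<eta> where "\<eta> > 0" "\<And>p q. p \<in> T \<Longrightarrow> q \<in> T \<Longrightarrow> p \<noteq> q \<Longrightarrow> \<eta> \<le> dist p q"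
proof -
  \<comment> \<open>Inserting 1 keeps the minimum defined when \<open>T\<close> has fewer than two
    points.\<close>
  let ?D = "insert 1 ((\<lambda>(p, q). dist p q) ` {(p, q). p \<in> T \<and> q \<in> T \<and> p \<noteq> q})"
  have "finite {(p, q). p \<in> T \<and> q \<in> T \<and> p \<noteq> q}"
    by (rule finite_subset[of _ "T \<times> T"]) (use assms in auto)
  then have fin: "finite ?D" by simp
  show thesis
  proof (rule that[of "Min ?D"])
    show "0 < Min ?D" using fin by (subst Min_gr_iff) auto
    show "Min ?D \<le> dist p q" if "p \<in> T" "q \<in> T" "p \<noteq> q" for p q
      using fin that by (intro Min_le) force+
  qed
qed

text \<open>Eilenberg-type estimate: for covers of mesh tending to \<open>0\<close>, the number of covering sets seen
  in the direction of \<open>y\<close> has bounded integral and is eventually at least the number of hits, so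
  Fatou's lemma applies.\<close>

lemma AE_finite_hits_ball:
  assumes len: "curve_length C < \<infinity>" and "0 < \<epsilon>" "0 < R"
  shows "AE y in lebesgue. y \<in> ball z R \<longrightarrow> finite (C \<inter> open_segment z y - ball z \<epsilon>)"
proof -
  have "\<exists>E :: nat \<Rightarrow> (real^2) set. C \<subseteq> (\<Union>i. E i) \<and> (\<forall>i. bounded (E i)) \<and>
      (\<forall>i. diameter (E i) \<le> inverse (real (Suc n))) \<and>
      (\<Sum>i. ennreal (diameter (E i))) \<le> curve_length C + 1" for n
    by (rule curve_length_cover[OF len, of "inverse (real (Suc n))"]) auto
  then obtain E :: "nat \<Rightarrow> nat \<Rightarrow> (real^2) set" where E: "\<And>n. C \<subseteq> (\<Union>i. E n i)" "\<And>n i. bounded (E n i)"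
    "\<And>n i. diameter (E n i) \<le> inverse (real (Suc n))"
    "\<And>n. (\<Sum>i. ennreal (diameter (E n i))) \<le> curve_length C + 1"
    by metis
  let ?k = "ennreal (4 * R\<^sup>2 / \<epsilon>)"
  have "\<exists>T. T \<in> sets lebesgue \<and> emeasure lebesgue T \<le> ?k * ennreal (diameter (E n i)) \<and>
    (\<forall>q y. q \<in> E n i - ball z \<epsilon> \<longrightarrow> q \<in> open_segment z y \<longrightarrow> y \<in> ball z R \<longrightarrow> y \<in> T)" for n i
    by (rule shadow_in_strip[OF E(2)[of n i] assms(2,3), of z]) blast
  then obtain T where T: "\<And>n i. T n i \<in> sets lebesgue"
    "\<And>n i. emeasure lebesgue (T n i) \<le> ?k * ennreal (diameter (E n i))"
    "\<And>n i q y. q \<in> E n i - ball z \<epsilon> \<Longrightarrow> q \<in> open_segment z y \<Longrightarrow> y \<in> ball z R \<Longrightarrow> y \<in> T n i"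
    by metis
  \<comment> \<open>The number of shadows of the \<open>n\<close>-th cover that contain
    \<open>y\<close>; its integral is bounded by the total diameter of the cover, uniformly in
    \<open>n\<close>.\<close>
  define N where "N n y = (\<Sum>i. indicator (T n i) y :: ennreal)" for n y
  note T(1)[measurable]
  have N_meas: "N n \<in> borel_measurable lebesgue" for n
    unfolding N_def by measurable
  have N_int: "(\<integral>\<^sup>+ y. N n y \<partial>lebesgue) \<le> ?k * (curve_length C + 1)" for n
  proof -
    have "(\<integral>\<^sup>+ y. N n y \<partial>lebesgue) = (\<Sum>i. \<integral>\<^sup>+ y. indicator (T n i) y \<partial>lebesgue)"
      unfolding N_def by (intro nn_integral_suminf) measurable
    also have "\<dots> = (\<Sum>i. emeasure lebesgue (T n i))"
      using T(1) by (simp add: nn_integral_indicator)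
    also have "\<dots> \<le> (\<Sum>i. ?k * ennreal (diameter (E n i)))"
      using T(2) by (intro suminf_le) auto
    also have "\<dots> = ?k * (\<Sum>i. ennreal (diameter (E n i)))"
      by (rule ennreal_suminf_cmult)
    also have "\<dots> \<le> ?k * (curve_length C + 1)"
      using E(4) by (intro mult_left_mono) auto
    finally show ?thesis .
  qed
  have "(\<integral>\<^sup>+ y. liminf (\<lambda>n. N n y) \<partial>lebesgue) \<le> liminf (\<lambda>n. \<integral>\<^sup>+ y. N n y \<partial>lebesgue)"
    by (rule nn_integral_liminf) (rule N_meas)
  also have "\<dots> \<le> ?k * (curve_length C + 1)"
    by (rule Liminf_le) (use N_int in auto)
  also have "\<dots> < \<infinity>" using len by (auto simp: ennreal_mult_less_top)
  finally have "(\<integral>\<^sup>+ y. liminf (\<lambda>n. N n y) \<partial>lebesgue) \<noteq> \<infinity>" by simp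
  then have "AE y in lebesgue. liminf (\<lambda>n. N n y) \<noteq> \<infinity>"
    by (intro nn_integral_PInf_AE) (use N_meas in measurable)
  then show ?thesis
  proof (rule AE_mp, intro always_eventually allI impI)
    fix y assume fin: "liminf (\<lambda>n. N n y) \<noteq> \<infinity>" and y: "y \<in> ball z R"
    let ?H = "C \<inter> open_segment z y - ball z \<epsilon>"
    show "finite ?H"
    proof (rule ccontr)
      assume inf: "infinite ?H"
      \<comment> \<open>Any \<open>m\<close> hits are separated by some \<eta>. Once the mesh is
        below \<eta> they lie in different covering sets, so \<open>y\<close> is in at least
        \<open>m\<close> shadows.\<close>
      have "of_nat m \<le> liminf (\<lambda>n. N n y)" for m
      proof -
        obtain Q where Q: "finite Q" "card Q = m" "Q \<subseteq> ?H"
          using infinite_arbitrarily_large[OF inf] by blast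
        obtain \<eta> where \<eta>: "\<eta> > 0" "\<And>p q. p \<in> Q \<Longrightarrow> q \<in> Q \<Longrightarrow> p \<noteq> q \<Longrightarrow> \<eta> \<le> dist p q"
          using finite_min_dist[OF Q(1)] by blast
        have "\<forall>\<^sub>F n in sequentially. inverse (real (Suc n)) < \<eta>"
          using order_tendstoD(2)[OF LIMSEQ_inverse_real_of_nat \<eta>(1)] .
        then have "\<forall>\<^sub>F n in sequentially. of_nat m \<le> N n y"
        proof eventually_elim
          case (elim n)
          have "\<forall>q\<in>Q. \<exists>i. q \<in> E n i" using Q(3) E(1)[of n] by blast
          then obtain f where f: "\<And>q. q \<in> Q \<Longrightarrow> q \<in> E n (f q)" by metis
          have "inj_on f Q"
          proof (rule inj_onI, rule ccontr)
            fix p q assume pq: "p \<in> Q" "q \<in> Q" "f p = f q" "p \<noteq> q"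
            have "dist p q \<le> diameter (E n (f p))"
              using diameter_bounded_bound[OF E(2)] f[OF pq(1)] f[OF pq(2)] pq(3) by simp
            also have "\<dots> < \<eta>" using E(3)[of n "f p"] elim by linarith
            finally show False using \<eta>(2)[OF pq(1,2,4)] by simp
          qed
          have "y \<in> T n (f q)" if "q \<in> Q" for q
            using T(3)[of q n "f q" y] f[OF that] that Q(3) y by blast
          then have "(\<Sum>i\<in>f ` Q. indicator (T n i) y :: ennreal) = (\<Sum>i\<in>f ` Q. 1)"
            by (intro sum.cong) auto
          also have "\<dots> = of_nat m" using Q(2) card_image[OF \<open>inj_on f Q\<close>] by simp
          finally show ?case unfolding N_def
            using sum_le_suminf[of "\<lambda>i. indicator (T n i) y :: ennreal" "f ` Q"] Q(1) by simp
        qed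
        then show ?thesis by (rule Liminf_bounded)
      qed
      then have "liminf (\<lambda>n. N n y) = \<infinity>"
        by (metis ennreal_Ex_less_of_nat infinity_ennreal_def not_less top.not_eq_extremum)
      with fin show False by blast
    qed
  qed
qed

text \<open>The bound for the shadows blows up as \<epsilon> tends to 0, so hits may still
  accumulate at \<open>z\<close> itself. Countably many radii suffice to get one null set for all
  \<epsilon>.\<close>

lemma AE_finite_hits:
  assumes "curve_length C < \<infinity>"
  shows "AE y in lebesgue. \<forall>\<epsilon>>0. finite (C \<inter> open_segment z y - ball z \<epsilon>)"
proof -
  have "AE y in lebesgue. \<forall>n m. y \<in> ball z (real (Suc m)) \<longrightarrow>
      finite (C \<inter> open_segment z y - ball z (inverse (real (Suc n))))"
    unfolding AE_all_countable using AE_finite_hits_ball[OF assms] by simp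
  then show ?thesis
  proof (rule AE_mp, intro always_eventually allI impI)
    fix y and \<epsilon> :: real
    assume *: "\<forall>n m. y \<in> ball z (real (Suc m)) \<longrightarrow>
      finite (C \<inter> open_segment z y - ball z (inverse (real (Suc n))))" and "\<epsilon> > 0"
    obtain n where n: "inverse (real (Suc n)) < \<epsilon>" using reals_Archimedean[OF \<open>\<epsilon> > 0\<close>] by blast
    obtain m where "dist z y < real m" using reals_Archimedean2 by blast
    then have "y \<in> ball z (real (Suc m))" by simp
    then have "finite (C \<inter> open_segment z y - ball z (inverse (real (Suc n))))" using * by blast
    then show "finite (C \<inter> open_segment z y - ball z \<epsilon>)"
      by (rule rev_finite_subset) (use n in auto)
  qed
qed

section \<open>Counting layers along a ray\<close>

text \<open>The rank \<open>card (T \<inter> {..w})\<close> is strictly increasing in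
  \<open>w\<close> and maps \<open>T\<close> bijectively onto \<open>{1..card T}\<close>.\<close>

lemma card_rank_filter:
  fixes T :: "'a::linorder set"
  assumes "finite T"
  shows "card {w \<in> T. card (T \<inter> {..w}) \<in> A} = card (A \<inter> {1..card T})"
proof -
  define r where "r w = card (T \<inter> {..w})" for w
  have less: "r v < r w" if "v \<in> T" "w \<in> T" "v < w" for v w
    unfolding r_def
  proof (rule psubset_card_mono)
    show "finite (T \<inter> {..w})" using assms by simp
    have "w \<in> T \<inter> {..w}" "w \<notin> T \<inter> {..v}" "T \<inter> {..v} \<subseteq> T \<inter> {..w}" using that by auto
    then show "T \<inter> {..v} \<subset> T \<inter> {..w}" by blast
  qed
  then have inj: "inj_on r T"
    by (intro inj_onI) (metis less_irrefl neqE)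
  have sub: "r ` T \<subseteq> {1..card T}"
  proof (clarify, simp only: atLeastAtMost_iff, intro conjI)
    fix w assume "w \<in> T"
    then have "T \<inter> {..w} \<noteq> {}" by auto
    then show "1 \<le> r w" using assms by (simp add: r_def Suc_le_eq card_gt_0_iff)
    show "r w \<le> card T" unfolding r_def using assms by (intro card_mono) auto
  qed
  have "card (r ` T) = card {1..card T}" using inj by (simp add: card_image)
  then have "r ` T = {1..card T}" using sub by (intro card_subset_eq) auto
  moreover have "r ` {w \<in> T. r w \<in> A} = A \<inter> r ` T" by auto
  ultimately have "r ` {w \<in> T. r w \<in> A} = A \<inter> {1..card T}" by simp
  moreover have "card (r ` {w \<in> T. r w \<in> A}) = card {w \<in> T. r w \<in> A}"
    by (rule card_image, rule inj_on_subset[OF inj]) auto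
  ultimately show ?thesis unfolding r_def by simp
qed

text \<open>In the parameter of the ray, the layer of a hit is its rank among all hits, counted from
  \<open>z\<close>. The index set \<open>A\<close> handles single layers and unions of layers
  together.\<close>

lemma card_layers_on_segment:
  assumes A: "0 \<notin> A" and fin: "\<And>\<epsilon>. \<epsilon> > 0 \<Longrightarrow> finite (C \<inter> open_segment z y - ball z \<epsilon>)"
  shows "card ((\<Union>n\<in>A. layer C z n) \<inter> open_segment z y) = card (A \<inter> {1..card (C \<inter> open_segment z y)})"
proof (cases "z = y")
  case True
  then show ?thesis by simp
next
  case False
  define f where "f w = (1 - w) *\<^sub>R z + w *\<^sub>R y" for w :: real
  define T where "T = {w \<in> {0<..<1}. f w \<in> C}"
  have inj: "inj f"
  proof (rule injI)
    fix v w assume "f v = f w"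
    then have "(v - w) *\<^sub>R (y - z) = 0" by (simp add: f_def algebra_simps)
    then show "v = w" using False by simp
  qed
  have seg: "open_segment z y = f ` {0<..<1}"
    using False by (simp add: open_segment_image_interval f_def[abs_def])
  have CT: "C \<inter> open_segment z y = f ` T" unfolding seg T_def by blast
  have card_f: "card (f ` S) = card S" for S
    using inj by (intro card_image inj_on_subset[OF inj]) auto
  have fin_f: "finite (f ` S) \<longleftrightarrow> finite S" for S
    using inj by (intro finite_image_iff inj_on_subset[OF inj]) auto
  have half: "{t *\<^sub>R f w + (1 - t) *\<^sub>R z | t :: real. t \<in> {0<..1}} \<inter> C = f ` (T \<inter> {..w})"
    if "w \<in> T" for w
  proof -
    have w: "0 < w" "w < 1" using that by (auto simp: T_def)
    have "t *\<^sub>R f w + (1 - t) *\<^sub>R z = f (t * w)" for t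
      by (simp add: f_def algebra_simps)
    then have "{t *\<^sub>R f w + (1 - t) *\<^sub>R z | t :: real. t \<in> {0<..1}} = f ` ((\<lambda>t. t * w) ` {0<..1})"
      by (simp only: image_image setcompr_eq_image Collect_mem_eq)
    also have "(\<lambda>t. t * w) ` {0<..1} = {0<..w}"
    proof
      show "(\<lambda>t. t * w) ` {0<..1} \<subseteq> {0<..w}" using w by (auto simp: mult_left_le_one_le)
      show "{0<..w} \<subseteq> (\<lambda>t. t * w) ` {0<..1}"
      proof
        fix v assume "v \<in> {0<..w}"
        then show "v \<in> (\<lambda>t. t * w) ` {0<..1}"
          using w by (intro image_eqI[of _ _ "v / w"]) auto
      qed
    qed
    finally show ?thesis using w by (auto simp: T_def)
  qed
  have "(\<Union>n\<in>A. layer C z n) \<inter> open_segment z y = {p \<in> C \<inter> open_segment z y.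
      card ({t *\<^sub>R p + (1 - t) *\<^sub>R z | t :: real. t \<in> {0<..1}} \<inter> C) \<in> A}"
    unfolding layer_def by blast
  also have "\<dots> = f ` {w \<in> T. card (T \<inter> {..w}) \<in> A}"
    unfolding CT using half card_f by auto
  finally have "card ((\<Union>n\<in>A. layer C z n) \<inter> open_segment z y) = card {w \<in> T. card (T \<inter> {..w}) \<in> A}"
    by (simp add: card_f)
  also have "\<dots> = card (A \<inter> {1..card T})"
  proof (cases "finite T")
    case True
    then show ?thesis by (rule card_rank_filter)
  next
    case False
    \<comment> \<open>Only finitely many hits lie beyond any given one, so infinitely many lie
      before it. Its rank then has the default value 0, which \<open>A\<close> excludes; the
      right-hand side is 0 as well, since \<open>card T\<close> is 0.\<close>
    have "infinite (T \<inter> {..w})" if "w \<in> T" for w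
    proof
      assume "finite (T \<inter> {..w})"
      have "f ` (T \<inter> {w<..}) \<subseteq> C \<inter> open_segment z y - ball z (w * dist z y)"
      proof (rule image_subsetI)
        fix v assume "v \<in> T \<inter> {w<..}"
        then have v: "v \<in> T" "v \<in> {w<..}" by auto
        have "f v - z = v *\<^sub>R (y - z)" by (simp add: f_def algebra_simps)
        then have "dist (f v) z = v * dist y z"
          using v(1) by (simp add: T_def dist_norm)
        then have "dist z (f v) = v * dist z y" by (simp only: dist_commute)
        moreover have "w * dist z y \<le> v * dist z y" using v(2) by (intro mult_right_mono) auto
        ultimately show "f v \<in> C \<inter> open_segment z y - ball z (w * dist z y)"
          unfolding CT using v(1) by auto
      qed
      moreover have "finite (C \<inter> open_segment z y - ball z (w * dist z y))"
      proof (rule fin)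
        have "0 < w" using that by (simp add: T_def)
        then show "0 < w * dist z y" using \<open>z \<noteq> y\<close> by simp
      qed
      ultimately have "finite (f ` (T \<inter> {w<..}))" by (rule finite_subset)
      then have "finite (T \<inter> {w<..})" by (simp only: fin_f)
      then have "finite ((T \<inter> {..w}) \<union> (T \<inter> {w<..}))" using \<open>finite (T \<inter> {..w})\<close> by simp
      moreover have "(T \<inter> {..w}) \<union> (T \<inter> {w<..}) = T" by auto
      ultimately show False using False by simp
    qed
    then have "{w \<in> T. card (T \<inter> {..w}) \<in> A} = {}" using A by auto
    then have "card {w \<in> T. card (T \<inter> {..w}) \<in> A} = 0" by (simp only: card.empty)
    moreover have "card (A \<inter> {1..card T}) = 0" using False by simp
    ultimately show ?thesis by (simp only:)
  qed
  finally show ?thesis by (simp only: CT card_f)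
qed

lemma layers_subset: "(\<Union>n\<in>A. layer C z n) \<subseteq> C"
  by (auto simp: layer_def)

lemma crossing_pairs_layers:
  assumes "0 \<notin> A" "\<And>\<epsilon>. \<epsilon> > 0 \<Longrightarrow> finite (C \<inter> open_segment z y - ball z \<epsilon>)" "transversal z y C"
  shows "(z, y) \<in> crossing_pairs (\<Union>n\<in>A. layer C z n) \<longleftrightarrow>
    odd (card (A \<inter> {1..card (C \<inter> open_segment z y)}))"
  using card_layers_on_segment[OF assms(1,2)] transversal_subset[OF assms(3) layers_subset]
  by (simp add: crossing_pairs_def)

section \<open>Borel measurability of hit counts\<close>

lemma infinite_or_le_card_iff:
  "infinite S \<or> n \<le> card S \<longleftrightarrow> (\<exists>Q\<subseteq>S. finite Q \<and> card Q = n)"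
proof
  assume "infinite S \<or> n \<le> card S"
  then show "\<exists>Q\<subseteq>S. finite Q \<and> card Q = n"
  proof
    assume "infinite S"
    then show ?thesis using infinite_arbitrarily_large by blast
  next
    assume "n \<le> card S"
    then show ?thesis by (metis obtain_subset_with_card_n)
  qed
next
  assume "\<exists>Q\<subseteq>S. finite Q \<and> card Q = n"
  then show "infinite S \<or> n \<le> card S" using card_mono by blast
qed

text \<open>A rational \<open>t\<close> can be placed between the largest of \<open>n + 1\<close>
  hits and the other \<open>n\<close>. This expresses the count as a countable union and drives an
  induction on \<open>n\<close>.\<close>

lemma Suc_le_card_iff_split:
  fixes T :: "real set"
  assumes T: "T \<subseteq> {0<..<1}"
  shows "infinite T \<or> Suc n \<le> card T \<longleftrightarrow>
    (\<exists>t\<in>\<rat> \<inter> {0<..<1}. (infinite (T \<inter> {..<t}) \<or> n \<le> card (T \<inter> {..<t})) \<and> T \<inter> {t..} \<noteq> {})"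
  (is "?L \<longleftrightarrow> ?R")
proof
  assume ?L
  then obtain Q where Q: "Q \<subseteq> T" "finite Q" "card Q = Suc n"
    unfolding infinite_or_le_card_iff by blast
  then have "Q \<noteq> {}" by auto
  define m where "m = Max Q"
  have m: "m \<in> Q" using Q \<open>Q \<noteq> {}\<close> by (simp add: m_def)
  \<comment> \<open>Inserting 0 forces the separating rational to be positive and keeps the maximum
    defined for \<open>n = 0\<close>.\<close>
  have "Max (insert 0 (Q - {m})) < m"
  proof (subst Max_less_iff)
    show "\<forall>a\<in>insert 0 (Q - {m}). a < m"
      using m Q(1,2) T by (auto simp: m_def order_less_le)
  qed (use Q in auto)
  then obtain t where t: "t \<in> \<rat>" "Max (insert 0 (Q - {m})) < t" "t < m"
    using Rats_dense_in_real by blast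
  have t': "\<forall>a\<in>insert 0 (Q - {m}). a < t"
    using t(2) Q(2) by (subst (asm) Max_less_iff) auto
  have "m < 1" using m Q(1) T by auto
  have "Q - {m} \<subseteq> T \<inter> {..<t}" using t' Q(1) by auto
  moreover have "card (Q - {m}) = n" using m Q by simp
  ultimately have "infinite (T \<inter> {..<t}) \<or> n \<le> card (T \<inter> {..<t})"
    unfolding infinite_or_le_card_iff using Q(2) by blast
  moreover have "m \<in> T \<inter> {t..}" using m Q(1) t(3) by auto
  moreover have "t \<in> \<rat> \<inter> {0<..<1}" using t t' \<open>m < 1\<close> by auto
  ultimately show ?R by blast
next
  assume ?R
  then obtain t s Q where Q: "Q \<subseteq> T \<inter> {..<t}" "finite Q" "card Q = n" and s: "s \<in> T \<inter> {t..}"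
    unfolding infinite_or_le_card_iff by blast
  then have "insert s Q \<subseteq> T" "card (insert s Q) = Suc n" by (auto simp: card_insert_if)
  then show ?L unfolding infinite_or_le_card_iff using Q(2) by blast
qed

text \<open>Solving for \<open>y\<close> gives a continuous map of the hit \<open>p\<close> and its
  parameter \<open>s\<close>, since \<open>s\<close> stays away from 0. The set is thus a countable
  union of images of compact products, with \<open>s\<close> bounded away from 1 on each.\<close>

lemma borel_ray_hits:
  fixes z :: "'a::euclidean_space"
  assumes "countable \<K>" "\<And>K. K \<in> \<K> \<Longrightarrow> compact K" "0 < t"
  shows "{y. \<exists>s\<in>{t..<1}. z + s *\<^sub>R (y - z) \<in> \<Union>\<K>} \<in> sets borel"
proof -
  let ?g = "\<lambda>(p, s). z + (1 / s) *\<^sub>R (p - z)"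
  have below: "s \<noteq> 0 \<and> s \<in> {t..<1}" if "s \<in> {t..1 - d}" "0 < d" for s d :: real
    using that assms(3) by auto
  have range: "s \<noteq> 0 \<and> s \<in> {t..<1}" if "s \<in> {t..1 - inverse (real (Suc n))}" for s n
    using that by (rule below) simp
  have "{y. \<exists>s\<in>{t..<1}. z + s *\<^sub>R (y - z) \<in> \<Union>\<K>}
      = (\<Union>K\<in>\<K>. \<Union>n. ?g ` (K \<times> {t..1 - inverse (real (Suc n))}))" (is "?A = ?B")
  proof
    show "?A \<subseteq> ?B"
    proof clarify
      fix y s K assume s: "s \<in> {t..<1}" and K: "K \<in> \<K>" "z + s *\<^sub>R (y - z) \<in> K"
      obtain n where "inverse (real (Suc n)) < 1 - s" using reals_Archimedean[of "1 - s"] s by auto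
      then have "(z + s *\<^sub>R (y - z), s) \<in> K \<times> {t..1 - inverse (real (Suc n))}" using s K by auto
      moreover have "y = ?g (z + s *\<^sub>R (y - z), s)" using s assms(3) by simp
      ultimately show "y \<in> ?B" using K(1) by blast
    qed
    show "?B \<subseteq> ?A"
    proof clarify
      fix K n p s assume *: "K \<in> \<K>" "p \<in> K" "s \<in> {t..1 - inverse (real (Suc n))}"
      have "s \<noteq> 0" "s \<in> {t..<1}" using range[OF *(3)] by blast+
      note s = this
      from s(1) have "z + s *\<^sub>R (z + (1 / s) *\<^sub>R (p - z) - z) = p" by simp
      then have "z + s *\<^sub>R (z + (1 / s) *\<^sub>R (p - z) - z) \<in> \<Union>\<K>" using *(1,2) by (simp only: UnionI)
      then show "\<exists>v\<in>{t..<1}. z + v *\<^sub>R (z + (1 / s) *\<^sub>R (p - z) - z) \<in> \<Union>\<K>"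
        using s(2) by (rule bexI)
    qed
  qed
  also have "\<dots> \<in> sets borel"
  proof (rule sets.countable_UN''[OF assms(1)], rule sets.countable_UN''[OF countableI_type], rule borel_compact)
    fix K n assume K: "K \<in> \<K>"
    have "s \<noteq> 0" if "s \<in> {t..1 - inverse (real (Suc n))}" for s
      using range[OF that] by blast
    then have "continuous_on (K \<times> {t..1 - inverse (real (Suc n))}) ?g"
      unfolding case_prod_beta by (intro continuous_intros) auto
    then show "compact (?g ` (K \<times> {t..1 - inverse (real (Suc n))}))"
      by (rule compact_continuous_image) (rule compact_Times[OF assms(2)[OF K] compact_Icc])
  qed
  finally show ?thesis .
qed

text \<open>The hits before parameter \<open>t\<close> on the way to \<open>y\<close> are, rescaled,
  the hits on the way to \<open>z + t *\<^sub>R (y - z)\<close>, so the set for \<open>n\<close>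
  enters the next one through a continuous preimage. The disjunct \<open>infinite\<close> is there
  because \<open>card\<close> is 0 on infinite sets.\<close>

lemma borel_hit_count:
  fixes z :: "'a::euclidean_space"
  assumes "countable \<K>" "\<And>K. K \<in> \<K> \<Longrightarrow> compact K"
  shows "{y. infinite {w \<in> {0<..<1}. z + w *\<^sub>R (y - z) \<in> \<Union>\<K>} \<or>
    n \<le> card {w \<in> {0<..<1}. z + w *\<^sub>R (y - z) \<in> \<Union>\<K>}} \<in> sets borel"
proof (induction n)
  case 0
  then show ?case by simp
next
  case (Suc n)
  define T where "T y = {w \<in> {0<..<1}. z + w *\<^sub>R (y - z) \<in> \<Union>\<K>}" for y
  define E where "E = {y. infinite (T y) \<or> n \<le> card (T y)}"
  have [measurable]: "E \<in> sets borel" using Suc by (simp add: E_def T_def)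
  have scale: "T y \<inter> {..<t} = (\<lambda>w. t * w) ` T (z + t *\<^sub>R (y - z))" if "t \<in> {0<..<1}" for y t
  proof
    show "T y \<inter> {..<t} \<subseteq> (\<lambda>w. t * w) ` T (z + t *\<^sub>R (y - z))"
    proof
      fix w assume "w \<in> T y \<inter> {..<t}"
      then show "w \<in> (\<lambda>w. t * w) ` T (z + t *\<^sub>R (y - z))"
        using that by (intro image_eqI[of _ _ "w / t"]) (auto simp: T_def)
    qed
    show "(\<lambda>w. t * w) ` T (z + t *\<^sub>R (y - z)) \<subseteq> T y \<inter> {..<t}"
    proof clarify
      fix w assume w: "w \<in> T (z + t *\<^sub>R (y - z))"
      have t: "0 < t" "t < 1" using that by auto
      have w': "0 < w" "w < 1" "z + w *\<^sub>R (z + t *\<^sub>R (y - z) - z) \<in> \<Union>\<K>"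
        using w by (simp_all add: T_def)
      have "t * w < t * 1" using w'(2) t(1) by (rule mult_strict_left_mono)
      then have "t * w < t" by (simp only: mult_1_right)
      moreover from this have "t * w < 1" using t(2) by (rule less_trans)
      moreover have "0 < t * w" using t(1) w'(1) by (rule mult_pos_pos)
      moreover have "z + (t * w) *\<^sub>R (y - z) \<in> \<Union>\<K>"
        using w'(3) by (simp only: add_diff_cancel_left' scaleR_scaleR mult.commute)
      ultimately show "t * w \<in> T y \<inter> {..<t}"
        by (simp only: T_def mem_Collect_eq Int_iff greaterThanLessThan_iff lessThan_iff simp_thms)
    qed
  qed
  have "{y. infinite (T y) \<or> Suc n \<le> card (T y)} =
    (\<Union>t\<in>\<rat> \<inter> {0<..<1}. {y. z + t *\<^sub>R (y - z) \<in> E} \<inter> {y. \<exists>s\<in>{t..<1}. z + s *\<^sub>R (y - z) \<in> \<Union>\<K>})"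
  proof (rule set_eqI)
    fix y
    have "T y \<subseteq> {0<..<1}" by (auto simp: T_def)
    note split = Suc_le_card_iff_split[OF this, of n]
    have 1: "infinite (T y \<inter> {..<t}) \<or> n \<le> card (T y \<inter> {..<t}) \<longleftrightarrow> z + t *\<^sub>R (y - z) \<in> E"
      if "t \<in> \<rat> \<inter> {0<..<1}" for t
    proof -
      have "inj_on (\<lambda>w. t * w) (T (z + t *\<^sub>R (y - z)))" using that by (auto simp: inj_on_def)
      then show ?thesis
        unfolding E_def using that by (simp add: scale card_image finite_image_iff)
    qed
    have 2: "T y \<inter> {t..} \<noteq> {} \<longleftrightarrow> (\<exists>s\<in>{t..<1}. z + s *\<^sub>R (y - z) \<in> \<Union>\<K>)"
      if "t \<in> \<rat> \<inter> {0<..<1}" for t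
    proof
      assume "T y \<inter> {t..} \<noteq> {}"
      then obtain w where "w \<in> T y" "w \<in> {t..}" by blast
      then have "w \<in> {t..<1}" "z + w *\<^sub>R (y - z) \<in> \<Union>\<K>" by (simp_all add: T_def)
      then show "\<exists>s\<in>{t..<1}. z + s *\<^sub>R (y - z) \<in> \<Union>\<K>" by (rule bexI[rotated])
    next
      assume "\<exists>s\<in>{t..<1}. z + s *\<^sub>R (y - z) \<in> \<Union>\<K>"
      then obtain w where w: "w \<in> {t..<1}" "z + w *\<^sub>R (y - z) \<in> \<Union>\<K>" by (rule bexE)
      moreover have "0 < w" using w(1) that by simp
      ultimately have "w \<in> T y" "w \<in> {t..}" by (simp_all add: T_def)
      then show "T y \<inter> {t..} \<noteq> {}" by blast
    qed
    show "y \<in> {y. infinite (T y) \<or> Suc n \<le> card (T y)} \<longleftrightarrow> y \<in> (\<Union>t\<in>\<rat> \<inter> {0<..<1}.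
        {y. z + t *\<^sub>R (y - z) \<in> E} \<inter> {y. \<exists>s\<in>{t..<1}. z + s *\<^sub>R (y - z) \<in> \<Union>\<K>})"
      unfolding mem_Collect_eq split UN_iff Int_iff[of y] using 1 2 by (intro bex_cong refl) simp
  qed
  also have "\<dots> \<in> sets borel"
  proof (rule sets.countable_UN''[OF countable_subset[OF Int_lower1 countable_rat]], rule sets.Int)
    fix t :: real assume t: "t \<in> \<rat> \<inter> {0<..<1}"
    have "(\<lambda>y. z + t *\<^sub>R (y - z)) \<in> borel_measurable borel" by measurable
    from measurable_sets[OF this \<open>E \<in> sets borel\<close>]
    show "{y. z + t *\<^sub>R (y - z) \<in> E} \<in> sets borel" by (simp add: vimage_def)
    have "0 < t" using t by simp
    with assms show "{y. \<exists>s\<in>{t..<1}. z + s *\<^sub>R (y - z) \<in> \<Union>\<K>} \<in> sets borel"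
      by (rule borel_ray_hits)
  qed
  finally show ?case by (simp only: T_def)
qed

text \<open>At \<open>y = z\<close> the open segment is empty while the parametrization is constant;
  \<open>z \<notin> C\<close> makes the two counts agree there.\<close>

lemma borel_card_open_segment:
  assumes "C1_manifold_1d C" "z \<notin> C"
  shows "{y. infinite (C \<inter> open_segment z y) \<or> n \<le> card (C \<inter> open_segment z y)} \<in> sets borel"
proof -
  obtain \<K> where \<K>: "countable \<K>" "\<And>K. K \<in> \<K> \<Longrightarrow> compact K" "\<Union>\<K> = C"
    using C1_manifold_countable_Union_compact[OF assms(1)] by blast
  define T where "T y = {w \<in> {0<..<1}. z + w *\<^sub>R (y - z) \<in> C}" for y
  have "C \<inter> open_segment z y = (\<lambda>w. z + w *\<^sub>R (y - z)) ` T y \<and> inj_on (\<lambda>w. z + w *\<^sub>R (y - z)) (T y)" for y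
  proof (cases "y = z")
    case True
    then show ?thesis using assms(2) by (simp add: T_def)
  next
    case False
    have "open_segment z y = (\<lambda>w. z + w *\<^sub>R (y - z)) ` {0<..<1}"
      using False by (simp add: open_segment_image_interval algebra_simps)
    then show ?thesis using False by (auto simp: T_def inj_on_def)
  qed
  then have "{y. infinite (C \<inter> open_segment z y) \<or> n \<le> card (C \<inter> open_segment z y)}
    = {y. infinite (T y) \<or> n \<le> card (T y)}"
    by (simp add: card_image finite_image_iff)
  then show ?thesis
    using borel_hit_count[OF \<K>(1,2), of z n] unfolding \<K>(3) T_def by simp
qed

section \<open>Curvatures of the layers\<close>

lemma of_bool_odd_min_eq_sum:
  "of_bool (odd (min N h)) = (\<Sum>n<N. (- 1) ^ (Suc n + 1) * of_bool (Suc n \<le> h) :: real)"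
proof (induction N)
  case (Suc N)
  show ?case
  proof (cases "Suc N \<le> h")
    case True
    then have "min (Suc N) h = Suc N" "min N h = N" by simp_all
    then have "of_bool (odd (min (Suc N) h)) = (of_bool (odd (min N h)) + (- 1) ^ (Suc N + 1) :: real)"
      by (cases "even N") simp_all
    then show ?thesis using Suc True by simp
  next
    case False
    then have "min (Suc N) h = min N h" by simp
    then show ?thesis using Suc False by simp
  qed
qed simp

text \<open>The exceptional set, where transversality or finiteness off balls fails, does not depend
  on \<open>n\<close> or \<open>N\<close>, so these quantifiers stand inside the almost everywhere
  statement.\<close>

lemma AE_crossing_layers:
  assumes "planar_curve C"
  shows "AE y in lebesgue.
    ((z, y) \<in> crossing_pairs C \<longleftrightarrow> odd (card (C \<inter> open_segment z y))) \<and>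
    (\<forall>n. (z, y) \<in> crossing_pairs (layer C z (Suc n)) \<longleftrightarrow> Suc n \<le> card (C \<inter> open_segment z y)) \<and>
    (\<forall>N. (z, y) \<in> crossing_pairs (\<Union>n\<in>{1..N}. layer C z n) \<longleftrightarrow>
       odd (min N (card (C \<inter> open_segment z y))))"
proof -
  have "C1_manifold_1d C" "curve_length C < \<infinity>" using assms by (simp_all add: planar_curve_def)
  from AE_transversal[OF this(1), of z] AE_finite_hits[OF this(2), of z]
  show ?thesis
  proof eventually_elim
    case (elim y)
    define h where "h = card (C \<inter> open_segment z y)"
    have layers: "(z, y) \<in> crossing_pairs (\<Union>n\<in>A. layer C z n) \<longleftrightarrow> odd (card (A \<inter> {1..h}))"
      if "0 \<notin> A" for A
      unfolding h_def using elim that by (intro crossing_pairs_layers) simp_all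
    have 1: "(z, y) \<in> crossing_pairs C \<longleftrightarrow> odd h"
      using elim by (simp add: crossing_pairs_def h_def)
    have 2: "(z, y) \<in> crossing_pairs (layer C z (Suc n)) \<longleftrightarrow> Suc n \<le> h" for n
    proof -
      have "card ({Suc n} \<inter> {1..h}) = of_bool (Suc n \<le> h)" by (cases "Suc n \<le> h") simp_all
      then show ?thesis using layers[of "{Suc n}"] by (cases "Suc n \<le> h") simp_all
    qed
    have 3: "(z, y) \<in> crossing_pairs (\<Union>n\<in>{1..N}. layer C z n) \<longleftrightarrow> odd (min N h)" for N
      using layers[of "{1..N}"] by simp
    show ?case using 1 2 3 unfolding h_def by blast
  qed
qed

lemma crossing_density_eq:
  "crossing_density \<sigma> z u S y =
     sgn ((y - z) \<bullet> u) / norm (z - y) powr (2 + \<sigma>) * of_bool ((z, y) \<in> crossing_pairs S)"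
  by (simp add: crossing_density_def indicator_def)

lemma borel_measurable_crossing_density:
  assumes "0 < \<sigma>" "has_pv_curvature \<sigma> z S u k"
  shows "crossing_density \<sigma> z u S \<in> borel_measurable lebesgue"
  using assms by (intro borel_measurable_of_outside_balls[of z]) (simp_all add: has_pv_curvature_iff)

text \<open>Linearity of the principal value. The identity holds only almost everywhere;
  completeness of Lebesgue measure transfers measurability from the sum to the density of
  \<open>T\<close>.\<close>

lemma has_pv_curvature_sum_AE:
  assumes "0 < \<sigma>" and pv: "\<And>i. i \<in> I \<Longrightarrow> has_pv_curvature \<sigma> z (S i) u (k i)"
    and ae: "AE y in lebesgue. (\<Sum>i\<in>I. c i * crossing_density \<sigma> z u (S i) y) = crossing_density \<sigma> z u T y"
  shows "has_pv_curvature \<sigma> z T u (\<Sum>i\<in>I. c i * k i)"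
proof -
  let ?f = "\<lambda>i. crossing_density \<sigma> z u (S i)" and ?t = "crossing_density \<sigma> z u T"
  let ?s = "\<lambda>y. \<Sum>i\<in>I. c i * ?f i y"
  have f: "set_integrable lebesgue (- ball z \<epsilon>) (?f i)" if "i \<in> I" "\<epsilon> > 0" for i \<epsilon>
    using pv[OF that(1)] that(2) by (simp add: has_pv_curvature_iff[OF assms(1)])
  have lim: "((\<lambda>\<epsilon>. set_lebesgue_integral lebesgue (- ball z \<epsilon>) (?f i)) \<longlongrightarrow> k i) (at_right 0)"
    if "i \<in> I" for i
    using pv[OF that(1)] by (simp add: has_pv_curvature_iff[OF assms(1)])
  have "?f i \<in> borel_measurable lebesgue" if "i \<in> I" for i
    using assms(1) pv[OF that] by (rule borel_measurable_crossing_density)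
  then have s_meas: "?s \<in> borel_measurable lebesgue"
    by (intro borel_measurable_sum borel_measurable_times borel_measurable_const)
  then have t_meas: "?t \<in> borel_measurable lebesgue"
    using ae by (rule borel_measurable_AE)
  have ind: "(\<lambda>y. indicat_real (- ball z \<epsilon>) y *\<^sub>R g y) \<in> borel_measurable lebesgue"
    if "g \<in> borel_measurable lebesgue" for g :: "real^2 \<Rightarrow> real" and \<epsilon>
    using that by (intro borel_measurable_scaleR borel_measurable_indicator) simp_all
  have ae': "AE y in lebesgue. indicat_real (- ball z \<epsilon>) y *\<^sub>R ?s y = indicat_real (- ball z \<epsilon>) y *\<^sub>R ?t y" for \<epsilon>
    using ae by eventually_elim simp
  have s_eq: "(\<lambda>y. indicat_real (- ball z \<epsilon>) y *\<^sub>R ?s y)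
      = (\<lambda>y. \<Sum>i\<in>I. c i * (indicat_real (- ball z \<epsilon>) y *\<^sub>R ?f i y))" for \<epsilon>
    by (simp add: sum_distrib_left mult.left_commute)
  have s_int: "integrable lebesgue (\<lambda>y. indicat_real (- ball z \<epsilon>) y *\<^sub>R ?s y)" if "\<epsilon> > 0" for \<epsilon>
    unfolding s_eq using f[OF _ that] unfolding set_integrable_def
    by (intro Bochner_Integration.integrable_sum integrable_mult_right)
  have t_int: "set_integrable lebesgue (- ball z \<epsilon>) ?t" if "\<epsilon> > 0" for \<epsilon>
    unfolding set_integrable_def using s_int[OF that] ind[OF t_meas] ae'
    by (rule integrable_cong_AE_imp)
  have eq: "set_lebesgue_integral lebesgue (- ball z \<epsilon>) ?t
      = (\<Sum>i\<in>I. c i * set_lebesgue_integral lebesgue (- ball z \<epsilon>) (?f i))" if "\<epsilon> > 0" for \<epsilon>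
  proof -
    have "set_lebesgue_integral lebesgue (- ball z \<epsilon>) ?t
        = integral\<^sup>L lebesgue (\<lambda>y. indicat_real (- ball z \<epsilon>) y *\<^sub>R ?s y)"
      unfolding set_lebesgue_integral_def
      by (rule sym, rule integral_cong_AE) (rule ind[OF s_meas] ind[OF t_meas] ae')+
    also have "\<dots> = (\<Sum>i\<in>I. integral\<^sup>L lebesgue (\<lambda>y. c i * (indicat_real (- ball z \<epsilon>) y *\<^sub>R ?f i y)))"
      unfolding s_eq using f[OF _ that] unfolding set_integrable_def
      by (intro Bochner_Integration.integral_sum integrable_mult_right)
    also have "\<dots> = (\<Sum>i\<in>I. c i * set_lebesgue_integral lebesgue (- ball z \<epsilon>) (?f i))"
      unfolding set_lebesgue_integral_def by simp
    finally show ?thesis .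
  qed
  have "((\<lambda>\<epsilon>. \<Sum>i\<in>I. c i * set_lebesgue_integral lebesgue (- ball z \<epsilon>) (?f i)) \<longlongrightarrow> (\<Sum>i\<in>I. c i * k i)) (at_right 0)"
    using lim by (intro tendsto_sum tendsto_mult tendsto_const)
  moreover have "\<forall>\<^sub>F \<epsilon> in at_right 0. (\<Sum>i\<in>I. c i * set_lebesgue_integral lebesgue (- ball z \<epsilon>) (?f i))
      = set_lebesgue_integral lebesgue (- ball z \<epsilon>) ?t"
    using eq by (auto simp: eventually_at_filter)
  ultimately have "((\<lambda>\<epsilon>. set_lebesgue_integral lebesgue (- ball z \<epsilon>) ?t) \<longlongrightarrow> (\<Sum>i\<in>I. c i * k i)) (at_right 0)"
    by (rule Lim_transform_eventually)
  then show ?thesis using t_int by (simp add: has_pv_curvature_iff[OF assms(1)])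
qed

text \<open>An integrable change of the density shifts the principal value by an ordinary integral,
  which separates the limit in \<epsilon> from the limit over the layers.\<close>

lemma has_pv_curvature_add_integrable:
  assumes "0 < \<sigma>" "has_pv_curvature \<sigma> z S u k" and \<rho>: "integrable lebesgue \<rho>"
    and eq: "\<And>y. crossing_density \<sigma> z u T y = crossing_density \<sigma> z u S y + \<rho> y"
  shows "has_pv_curvature \<sigma> z T u (k + integral\<^sup>L lebesgue \<rho>)"
proof -
  let ?f = "crossing_density \<sigma> z u S"
  have f: "\<And>\<epsilon>. \<epsilon> > 0 \<Longrightarrow> set_integrable lebesgue (- ball z \<epsilon>) ?f"
    and lim: "((\<lambda>\<epsilon>. set_lebesgue_integral lebesgue (- ball z \<epsilon>) ?f) \<longlongrightarrow> k) (at_right 0)"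
    using assms(2) by (simp_all add: has_pv_curvature_iff[OF assms(1)])
  have \<rho>_int: "set_integrable lebesgue (- ball z \<epsilon>) \<rho>" for \<epsilon>
    unfolding set_integrable_def using \<rho> by (rule integrable_mult_indicator[rotated]) simp
  have "\<rho> z = 0" using eq[of z] by simp
  have eqf: "crossing_density \<sigma> z u T = (\<lambda>y. ?f y + \<rho> y)" by (rule ext) (rule eq)
  have "((\<lambda>\<epsilon>. set_lebesgue_integral lebesgue (- ball z \<epsilon>) ?f + set_lebesgue_integral lebesgue (- ball z \<epsilon>) \<rho>)
      \<longlongrightarrow> k + integral\<^sup>L lebesgue \<rho>) (at_right 0)"
    using lim tendsto_integral_outside_ball[where f = \<rho> and z = z, OF \<rho> \<open>\<rho> z = 0\<close>] by (rule tendsto_add)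
  moreover have "\<forall>\<^sub>F \<epsilon> in at_right 0. set_lebesgue_integral lebesgue (- ball z \<epsilon>) ?f
      + set_lebesgue_integral lebesgue (- ball z \<epsilon>) \<rho>
      = set_lebesgue_integral lebesgue (- ball z \<epsilon>) (crossing_density \<sigma> z u T)"
    using set_integral_add(2)[OF f \<rho>_int] by (simp add: eqf eventually_at_filter)
  ultimately have "((\<lambda>\<epsilon>. set_lebesgue_integral lebesgue (- ball z \<epsilon>) (crossing_density \<sigma> z u T))
      \<longlongrightarrow> k + integral\<^sup>L lebesgue \<rho>) (at_right 0)"
    by (rule Lim_transform_eventually)
  moreover have "set_integrable lebesgue (- ball z \<epsilon>) (crossing_density \<sigma> z u T)" if "\<epsilon> > 0" for \<epsilon>
    unfolding eqf using f[OF that] \<rho>_int by (rule set_integral_add(1))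
  ultimately show ?thesis by (simp add: has_pv_curvature_iff[OF assms(1)])
qed

lemma pv_curvature_layers:
  assumes "0 < \<sigma>" "planar_curve C"
    and pv: "\<And>n. has_pv_curvature \<sigma> z (layer C z (Suc n)) u (k n)"
    and ker: "kernel_integrable \<sigma> z (layer C z (Suc m))"
  defines "K \<equiv> \<lambda>N. \<Sum>n<N. (- 1) ^ (Suc n + 1) * k n"
  shows "has_pv_curvature \<sigma> z (\<Union>n\<in>{1..N}. layer C z n) u (K N)"
    and "\<exists>l. has_pv_curvature \<sigma> z C u l \<and> K \<longlonglongrightarrow> l"
proof -
  define h where "h y = card (C \<inter> open_segment z y)" for y
  define g where "g y = sgn ((y - z) \<bullet> u) / norm (z - y) powr (2 + \<sigma>)" for y
  let ?U = "\<lambda>N. \<Union>n\<in>{1..N}. layer C z n"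
  let ?d = "crossing_density \<sigma> z u"
  have good: "AE y in lebesgue. ?d C y = g y * of_bool (odd (h y)) \<and>
      (\<forall>n. ?d (layer C z (Suc n)) y = g y * of_bool (Suc n \<le> h y)) \<and>
      (\<forall>N. ?d (?U N) y = g y * of_bool (odd (min N (h y)))) \<and>
      (\<forall>n. (z, y) \<in> crossing_pairs (layer C z (Suc n)) \<longleftrightarrow> Suc n \<le> h y)"
    using AE_crossing_layers[OF assms(2), of z]
    by eventually_elim (simp only: crossing_density_eq g_def h_def simp_thms)
  have U_pv: "has_pv_curvature \<sigma> z (?U N) u (K N)" for N
    unfolding K_def
  proof (rule has_pv_curvature_sum_AE[OF assms(1) pv])
    show "AE y in lebesgue. (\<Sum>n<N. (- 1) ^ (Suc n + 1) * ?d (layer C z (Suc n)) y) = ?d (?U N) y"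
      using good
    proof eventually_elim
      case (elim y)
      then have "?d (?U N) y = g y * of_bool (odd (min N (h y)))" by blast
      also have "\<dots> = (\<Sum>n<N. (- 1) ^ (Suc n + 1) * (g y * of_bool (Suc n \<le> h y)))"
        unfolding of_bool_odd_min_eq_sum sum_distrib_left by (simp only: mult.left_commute)
      also have "\<dots> = (\<Sum>n<N. (- 1) ^ (Suc n + 1) * ?d (layer C z (Suc n)) y)"
        using elim by (intro sum.cong refl) simp
      finally show ?case by (rule sym)
    qed
  qed
  then show "has_pv_curvature \<sigma> z (?U N) u (K N)" .
  have U_meas: "?d (?U N) \<in> borel_measurable lebesgue" for N
    using assms(1) U_pv by (rule borel_measurable_crossing_density)
  define M where "M = Suc m"
  \<comment> \<open>Measured from the union of the first \<open>M\<close> layers: on rays with fewer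
    than \<open>M\<close> hits both terms agree, and elsewhere layer \<open>M\<close> is crossed, so
    the kernel on its crossing set is a majorant for every \<open>N\<close>.\<close>
  define \<rho> where "\<rho> N y = ?d (?U (N + M)) y - ?d (?U M) y" for N y
  define \<rho>' where "\<rho>' y = ?d C y - ?d (?U M) y" for y
  define w where "w y = indicator {y. (z, y) \<in> crossing_pairs (layer C z M)} y *\<^sub>R (1 / norm (z - y) powr (2 + \<sigma>))" for y
  have w: "integrable lebesgue w"
    using ker unfolding kernel_integrable_def set_integrable_def w_def M_def .
  have U_lim: "AE y in lebesgue. (\<lambda>N. ?d (?U N) y) \<longlonglongrightarrow> ?d C y"
    using good
  proof eventually_elim
    case (elim y)
    have "\<forall>\<^sub>F N in sequentially. ?d (?U N) y = ?d C y"
      using eventually_ge_at_top[of "h y"]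
    proof eventually_elim
      fix N assume "h y \<le> N"
      then have "min N (h y) = h y" by simp
      then show "?d (?U N) y = ?d C y" using elim by simp
    qed
    then show ?case by (rule tendsto_eventually)
  qed
  \<comment> \<open>The curvature of \<open>C\<close> is a conclusion, so measurability of its
    density is obtained from the unions, whose densities are almost everywhere eventually constant
    in \<open>N\<close>.\<close>
  have "(\<lambda>y. lim (\<lambda>N. ?d (?U N) y)) \<in> borel_measurable lebesgue"
    using U_meas by (rule borel_measurable_lim_metric)
  moreover have "AE y in lebesgue. lim (\<lambda>N. ?d (?U N) y) = ?d C y"
    using U_lim by eventually_elim (rule limI)
  ultimately have C_meas: "?d C \<in> borel_measurable lebesgue" by (rule borel_measurable_AE)
  have \<rho>_meas: "\<rho> N \<in> borel_measurable lebesgue" for N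
    unfolding \<rho>_def using U_meas U_meas by (rule borel_measurable_diff)
  have \<rho>'_meas: "\<rho>' \<in> borel_measurable lebesgue"
    unfolding \<rho>'_def using C_meas U_meas by (rule borel_measurable_diff)
  have \<rho>_lim: "AE y in lebesgue. (\<lambda>N. \<rho> N y) \<longlonglongrightarrow> \<rho>' y"
    using U_lim
  proof eventually_elim
    case (elim y)
    have "(\<lambda>N. ?d (?U (N + M)) y) \<longlonglongrightarrow> ?d C y"
      using elim by (rule LIMSEQ_ignore_initial_segment)
    then show ?case unfolding \<rho>_def \<rho>'_def by (intro tendsto_diff tendsto_const)
  qed
  have \<rho>_bound: "AE y in lebesgue. norm (\<rho> N y) \<le> w y" for N
    using good
  proof eventually_elim
    case (elim y)
    have e: "\<rho> N y = g y * (of_bool (odd (min (N + M) (h y))) - of_bool (odd (min M (h y))))"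
      using elim unfolding \<rho>_def by (simp only: right_diff_distrib)
    show ?case
    proof (cases "M \<le> h y")
      case True
      then have "(z, y) \<in> crossing_pairs (layer C z M)" using elim by (simp add: M_def)
      then have "w y = 1 / norm (z - y) powr (2 + \<sigma>)" by (simp add: w_def)
      moreover have "norm (g y) \<le> 1 / norm (z - y) powr (2 + \<sigma>)"
        by (simp add: g_def divide_right_mono abs_sgn_eq)
      moreover have "norm (\<rho> N y) \<le> norm (g y) * 1"
        unfolding e norm_mult by (intro mult_left_mono) (simp_all add: of_bool_def)
      ultimately show ?thesis by simp
    next
      case False
      then have "min (N + M) (h y) = min M (h y)" by simp
      then show ?thesis by (simp add: e w_def)
    qed
  qed
  have \<rho>'_int: "integrable lebesgue \<rho>'" and \<rho>_int: "\<And>N. integrable lebesgue (\<rho> N)"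
    and int_lim: "(\<lambda>N. integral\<^sup>L lebesgue (\<rho> N)) \<longlonglongrightarrow> integral\<^sup>L lebesgue \<rho>'"
    using integrable_dominated_convergence[OF \<rho>'_meas \<rho>_meas w \<rho>_lim \<rho>_bound]
      integrable_dominated_convergence2[OF \<rho>'_meas \<rho>_meas w \<rho>_lim \<rho>_bound]
      integral_dominated_convergence[OF \<rho>'_meas \<rho>_meas w \<rho>_lim \<rho>_bound] by blast+
  \<comment> \<open>A second evaluation of the curvature of this union; uniqueness turns it into a
    formula for the partial sums whose limit is known.\<close>
  have "has_pv_curvature \<sigma> z (?U (N + M)) u (K M + integral\<^sup>L lebesgue (\<rho> N))" for N
    by (rule has_pv_curvature_add_integrable[OF assms(1) U_pv \<rho>_int]) (simp add: \<rho>_def)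
  then have "K (N + M) = K M + integral\<^sup>L lebesgue (\<rho> N)" for N
    using has_pv_curvature_unique U_pv by blast
  then have "(\<lambda>N. K (N + M)) \<longlonglongrightarrow> K M + integral\<^sup>L lebesgue \<rho>'"
    using int_lim by (simp add: tendsto_add)
  then have "K \<longlonglongrightarrow> K M + integral\<^sup>L lebesgue \<rho>'" by (rule LIMSEQ_offset)
  moreover have "has_pv_curvature \<sigma> z C u (K M + integral\<^sup>L lebesgue \<rho>')"
    by (rule has_pv_curvature_add_integrable[OF assms(1) U_pv \<rho>'_int]) (simp add: \<rho>'_def)
  ultimately show "\<exists>l. has_pv_curvature \<sigma> z C u l \<and> K \<longlonglongrightarrow> l" by blast
qed

text \<open>The crossing set of a layer misses a ball about \<open>z\<close>, and outside it the
  kernel is integrable. Measurability comes from the Borel hit counts of \<open>C\<close>, not from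
  any assumed curvature.\<close>

lemma layers_away_from_curve:
  assumes "0 < \<sigma>" "planar_curve C" "z \<notin> closure C"
  shows "kernel_integrable \<sigma> z (layer C z (Suc n))"
    and "\<exists>k. has_pv_curvature \<sigma> z (layer C z (Suc n)) u k"
proof -
  obtain r where r: "r > 0" "ball z r \<inter> C = {}"
  proof -
    obtain r where "r > 0" "ball z r \<subseteq> - closure C"
      using assms(3) open_contains_ball[of "- closure C"] by auto
    moreover have "C \<subseteq> closure C" by (rule closure_subset)
    ultimately show thesis by (intro that[of r]) auto
  qed
  have "z \<notin> C" using assms(3) closure_subset by blast
  let ?X = "{y. (z, y) \<in> crossing_pairs (layer C z (Suc n))}"
  let ?E = "{y. infinite (C \<inter> open_segment z y) \<or> Suc n \<le> card (C \<inter> open_segment z y)}"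
  define \<phi> where "\<phi> y = indicator ?X y *\<^sub>R (1 / norm (z - y) powr (2 + \<sigma>))" for y
  have E: "?E \<in> sets borel"
    using assms(2) \<open>z \<notin> C\<close> by (intro borel_card_open_segment) (simp_all add: planar_curve_def)
  have "(\<lambda>y. indicator ?E y *\<^sub>R (1 / norm (z - y) powr (2 + \<sigma>))) \<in> borel_measurable borel"
    using E by measurable
  then have E_meas: "(\<lambda>y. indicator ?E y *\<^sub>R (1 / norm (z - y) powr (2 + \<sigma>))) \<in> borel_measurable lebesgue"
    by (intro measurable_completion) simp
  have "AE y in lebesgue. \<forall>\<epsilon>>0. finite (C \<inter> open_segment z y - ball z \<epsilon>)"
    using assms(2) by (intro AE_finite_hits) (simp add: planar_curve_def)
  with AE_crossing_layers[OF assms(2), of z]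
  have "AE y in lebesgue. indicator ?E y *\<^sub>R (1 / norm (z - y) powr (2 + \<sigma>)) = \<phi> y"
  proof eventually_elim
    case (elim y)
    have "C \<inter> open_segment z y - ball z r = C \<inter> open_segment z y" using r(2) by blast
    \<comment> \<open>The removed ball contains no hits, so finiteness off it is full finiteness and
      the alternative \<open>infinite\<close> in \<open>?E\<close> does not occur.\<close>
    then have "finite (C \<inter> open_segment z y)" using elim(2) r(1) by (metis (no_types, lifting))
    then have "y \<in> ?E \<longleftrightarrow> y \<in> ?X" using elim(1) by simp
    then show ?case by (simp add: \<phi>_def indicator_def)
  qed
  with E_meas have \<phi>_meas: "\<phi> \<in> borel_measurable lebesgue" by (rule borel_measurable_AE)
  have X_ball: "y \<notin> ball z r" if "y \<in> ?X" for y
  proof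
    assume "y \<in> ball z r"
    then have "open_segment z y \<subseteq> ball z r"
      using r(1) convex_ball by (metis centre_in_ball convex_contains_open_segment)
    then have "C \<inter> open_segment z y = {}" using r(2) by blast
    then have "layer C z (Suc n) \<inter> open_segment z y = {}" by (auto simp: layer_def)
    then show False using that by (simp add: crossing_pairs_def)
  qed
  have dom: "integrable lebesgue (\<lambda>y. indicator (- ball z r) y *\<^sub>R (1 / norm (z - y) powr (2 + \<sigma>)))"
    using integrable_powr_outside_ball[of "2 + \<sigma>" r z] assms(1) r(1) by (simp add: set_integrable_def)
  have \<phi>_le: "norm (\<phi> y) \<le> norm (indicator (- ball z r) y *\<^sub>R (1 / norm (z - y) powr (2 + \<sigma>)))" for y
    using X_ball[of y] by (cases "y \<in> ?X") (simp_all add: \<phi>_def)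
  have "integrable lebesgue \<phi>"
    using dom \<phi>_meas by (rule Bochner_Integration.integrable_bound) (simp only: \<phi>_le eventually_True)
  then show "kernel_integrable \<sigma> z (layer C z (Suc n))"
    unfolding kernel_integrable_def set_integrable_def \<phi>_def .
  let ?d = "crossing_density \<sigma> z u (layer C z (Suc n))"
  have d_eq: "?d = (\<lambda>y. sgn ((y - z) \<bullet> u) * \<phi> y)"
    by (rule ext) (simp add: crossing_density_def \<phi>_def)
  have "(\<lambda>y. sgn ((y - z) \<bullet> u)) \<in> borel_measurable borel" by measurable
  then have "(\<lambda>y. sgn ((y - z) \<bullet> u)) \<in> borel_measurable lebesgue"
    by (intro measurable_completion) simp
  then have d_meas: "?d \<in> borel_measurable lebesgue"
    unfolding d_eq using \<phi>_meas by (rule borel_measurable_times)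
  have "norm (?d y) \<le> norm (\<phi> y)" for y
    unfolding d_eq real_norm_def abs_mult by (simp add: abs_sgn_eq)
  then have "AE y in lebesgue. norm (?d y) \<le> norm (\<phi> y)" by (rule AE_I2)
  with \<open>integrable lebesgue \<phi>\<close> d_meas have "integrable lebesgue ?d"
    by (rule Bochner_Integration.integrable_bound)
  then show "\<exists>k. has_pv_curvature \<sigma> z (layer C z (Suc n)) u k"
    using has_pv_curvature_of_integrable[OF assms(1)] by blast
qed

theorem proposition4:
  fixes \<sigma> :: real and C :: "(real^2) set" and z u :: "real^2"
  assumes "0 < \<sigma>" and "\<sigma> < 1"
    and "planar_curve C"
    and "norm u = 1"
    and "z \<in> C \<Longrightarrow> unit_normal C z u"
    and "z \<in> closure C \<Longrightarrow>
           \<forall>n\<ge>1. nonlocal_curvature_exists \<sigma> z (layer C z n) u"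
    and "z \<in> closure C \<Longrightarrow> \<exists>m\<ge>1. kernel_integrable \<sigma> z (layer C z m)"
  shows "nonlocal_curvature_exists \<sigma> z C u \<and>
    (\<forall>n\<ge>1. nonlocal_curvature_exists \<sigma> z (layer C z n) u) \<and>
    (\<forall>N. nonlocal_curvature_exists \<sigma> z (\<Union>n\<in>{1..N}. layer C z n) u) \<and>
    (\<lambda>n. (-1) ^ (Suc n + 1) * nonlocal_curvature \<sigma> z (layer C z (Suc n)) u)
      sums nonlocal_curvature \<sigma> z C u \<and>
    (\<lambda>N. nonlocal_curvature \<sigma> z (\<Union>n\<in>{1..N}. layer C z n) u)
      \<longlonglongrightarrow> nonlocal_curvature \<sigma> z C u"
proof -
  let ?U = "\<lambda>N. \<Union>n\<in>{1..N}. layer C z n"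
  \<comment> \<open>At points of the closure the layer curvatures exist by assumption; elsewhere the
    positive distance from \<open>C\<close> provides them.\<close>
  have "\<exists>k. has_pv_curvature \<sigma> z (layer C z (Suc n)) u k" for n
  proof (cases "z \<in> closure C")
    case True
    then have "nonlocal_curvature_exists \<sigma> z (layer C z (Suc n)) u" using assms(6) by simp
    then show ?thesis by (simp add: nonlocal_curvature_exists_def has_nonlocal_curvature_iff_pv)
  next
    case False
    with assms(1,3) show ?thesis by (rule layers_away_from_curve)
  qed
  then obtain k where k: "\<And>n. has_pv_curvature \<sigma> z (layer C z (Suc n)) u (k n)" by metis
  obtain m where m: "kernel_integrable \<sigma> z (layer C z (Suc m))"
  proof (cases "z \<in> closure C")
    case True
    then obtain m where "m \<ge> 1" "kernel_integrable \<sigma> z (layer C z m)" using assms(7) by blast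
    then show thesis by (intro that[of "m - 1"]) simp
  next
    case False
    from layers_away_from_curve(1)[OF assms(1,3) False] show thesis by (rule that)
  qed
  define K where "K N = (\<Sum>n<N. (- 1) ^ (Suc n + 1) * k n)" for N
  have U: "has_pv_curvature \<sigma> z (?U N) u (K N)" for N
    unfolding K_def by (rule pv_curvature_layers(1)[OF assms(1,3) k m])
  obtain l where l: "has_pv_curvature \<sigma> z C u l" and lim: "K \<longlonglongrightarrow> l"
    using pv_curvature_layers(2)[OF assms(1,3) k m] unfolding K_def by blast
  note iff = has_nonlocal_curvature_iff_pv
  have ex: "nonlocal_curvature_exists \<sigma> z S u" if "has_pv_curvature \<sigma> z S u a" for S a
    using that unfolding nonlocal_curvature_exists_def iff by blast
  have eq: "nonlocal_curvature \<sigma> z S u = a" if "has_pv_curvature \<sigma> z S u a" for S a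
    using that by (intro nonlocal_curvature_eqI) (simp only: iff)
  have "\<forall>n\<ge>1. nonlocal_curvature_exists \<sigma> z (layer C z n) u"
  proof (intro allI impI)
    fix n :: nat assume "n \<ge> 1"
    then obtain i where "n = Suc i" by (cases n) simp_all
    then show "nonlocal_curvature_exists \<sigma> z (layer C z n) u" using ex[OF k[of i]] by simp
  qed
  moreover have "(\<lambda>n. (-1) ^ (Suc n + 1) * nonlocal_curvature \<sigma> z (layer C z (Suc n)) u)
      sums nonlocal_curvature \<sigma> z C u"
    using lim unfolding sums_def eq[OF k] eq[OF l] K_def .
  moreover have "(\<lambda>N. nonlocal_curvature \<sigma> z (?U N) u) \<longlonglongrightarrow> nonlocal_curvature \<sigma> z C u"
    using lim unfolding eq[OF U] eq[OF l] .
  ultimately show ?thesis using ex[OF l] ex[OF U] by blast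
qed

end
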